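(* Let $\mathrm{Cay}(B,Y)$ be a connected Cayley graph on a finite abelian group $B$, with $Y=-Y=\{\pm y_1,\dots,\pm y_l\}\cup\{y'_1,\dots,y'_{l'}\}$ as in the context, and let $A^{0}$ and $F$ be finite abelian groups. Put $$R(Y)=\Big\{(a_1,\dots,a_{l+l'})\in\mathbb{Z}^{l+l'}:\ \sum_{i=1}^{l}a_iy_i+\sum_{j=1}^{l'}a_{l+j}y'_j=0\Big\},$$ $$R_0=\{(a_1,\dots,a_{l+l'})\in\mathbb{Z}^{l+l'}:\ a_1=\cdots=a_l=0,\ 2\mid a_{l+j}\text{ for }1\le j\le l'\},$$ $$R=\{(a_1,\dots,a_{l+l'})\in\mathbb{Z}^{l+l'}:\ \exp(B)\exp(F)\mid a_i\text{ for }1\le i\le l+l'\},$$ and $\overline{R(Y)}=R(Y)/R$, $\overline{R_0}=(R_0+R)/R$, both subgroups of $\mathbb{Z}^{l+l'}/R$. Then the isomorphism classes of typical abelian coverings $\mathrm{Cay}(A,X)\to\mathrm{Cay}(B,Y)$ such that $A\cong A^{0}$ and the covering transformation group is isomorphic to $F$ are in one-to-one correspondence with the subgroups $D$ of $\overline{R(Y)}$ such that $\overline{R_0}\leqslant D$, $(\mathbb{Z}^{l+l'}/R)/D\cong A^{0}$ and $\overline{R(Y)}/D\cong F$.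
   Context: All graphs are finite, simple and connected; all groups are abelian, written additively. For a finite abelian group $A$ and a subset $X\subseteq A$ with $X=-X$ and $0\notin X$, the Cayley graph $\mathrm{Cay}(A,X)$ has vertex set $A$ and edge set $\{\{g,g+x\}: g\in A,\ x\in X\}$; it is connected iff $X$ generates $A$. A covering of graphs $p:\tilde G\to G$ is a surjection $p:V(\tilde G)\to V(G)$ such that $p|_{N(\tilde v)}:N(\tilde v)\to N(v)$ is bijective for all $v\in V(G)$ and $\tilde v\in p^{-1}(v)$, where $N(\cdot)$ denotes the set of adjacent vertices. Two coverings $p_i:\tilde G_i\to G$ ($i=1,2$) are isomorphic if there is a graph isomorphism $\Phi:\tilde G_1\to\tilde G_2$ with $p_2\circ\Phi=p_1$. A typical (abelian) covering $\mathrm{Cay}(A,X)\to\mathrm{Cay}(B,Y)$ is a covering induced by a surjective homomorphism $f:A\to B$ of finite abelian groups with $f(X)=Y$; it is always assumed that $X\cap\ker f=\emptyset$ and that $f|_X:X\to Y$ is bijective. Its covering transformation group is $\ker f$. Standing notation: $Y=-Y$, $0\notin Y$, $\langle Y\rangle=B$, and $Y=\{\pm y_1,\dots,\pm y_l\}\cup\{y'_1,\dots,y'_{l'}\}$ with $2y_i\neq0$ for $1\le i\le l$ and $2y'_j=0$ for $1\le j\le l'$, the $2l+l'$ listed elements being distinct (so the graph has valence $2l+l'$). $\exp(A)$ is the exponent of $A$, the least positive integer $s$ with $sa=0$ for all $a\in A$. *)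

theory Defs
  imports "HOL-Algebra.Product_Groups" "HOL-Algebra.FiniteProduct"
begin

text \<open>
  Groups are records of HOL-Algebra, so abelian groups are written multiplicatively here:
  the sum \<open>a\<^sub>1 y\<^sub>1 + ... + a\<^sub>n y\<^sub>n\<close> of the additive notation is a product
  of powers with integer exponents.
\<close>

record 'v graph =
  verts :: "'v set"
  edges :: "'v set set"

definition neighbours :: "'v graph \<Rightarrow> 'v \<Rightarrow> 'v set"
  where "neighbours G v = {u \<in> verts G. {v, u} \<in> edges G}"

definition connected_graph :: "'v graph \<Rightarrow> bool"
  where "connected_graph G \<longleftrightarrow> verts G \<noteq> {} \<and>
    (\<forall>u \<in> verts G. \<forall>v \<in> verts G. (u, v) \<in> {(a, b). {a, b} \<in> edges G}\<^sup>*)"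

definition finite_simple_connected :: "'v graph \<Rightarrow> bool"
  where "finite_simple_connected G \<longleftrightarrow> finite (verts G) \<and>
    (\<forall>e \<in> edges G. e \<subseteq> verts G \<and> card e = 2) \<and> connected_graph G"

definition graph_iso :: "('v \<Rightarrow> 'w) \<Rightarrow> 'v graph \<Rightarrow> 'w graph \<Rightarrow> bool"
  where "graph_iso \<Phi> G H \<longleftrightarrow> bij_betw \<Phi> (verts G) (verts H) \<and>
    (\<forall>u \<in> verts G. \<forall>v \<in> verts G. {u, v} \<in> edges G \<longleftrightarrow> {\<Phi> u, \<Phi> v} \<in> edges H)"

definition graph_covering :: "('w \<Rightarrow> 'v) \<Rightarrow> 'w graph \<Rightarrow> 'v graph \<Rightarrow> bool"
  where "graph_covering p G' G \<longleftrightarrow>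
    finite_simple_connected G' \<and> finite_simple_connected G \<and>
    p ` verts G' = verts G \<and>
    (\<forall>v \<in> verts G. \<forall>v' \<in> verts G'. p v' = v \<longrightarrow>
       bij_betw p (neighbours G' v') (neighbours G v))"

definition isomorphic_coverings ::
    "'w graph \<Rightarrow> ('w \<Rightarrow> 'v) \<Rightarrow> 'x graph \<Rightarrow> ('x \<Rightarrow> 'v) \<Rightarrow> bool"
  where "isomorphic_coverings G1 p1 G2 p2 \<longleftrightarrow>
    (\<exists>\<Phi>. graph_iso \<Phi> G1 G2 \<and> (\<forall>v \<in> verts G1. p2 (\<Phi> v) = p1 v))"

definition cayley_subset :: "('a, 'm) monoid_scheme \<Rightarrow> 'a set \<Rightarrow> bool"
  where "cayley_subset A X \<longleftrightarrow>
    X \<subseteq> carrier A \<and> m_inv A ` X = X \<and> \<one>\<^bsub>A\<^esub> \<notin> X"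

definition Cay :: "('a, 'm) monoid_scheme \<Rightarrow> 'a set \<Rightarrow> 'a graph"
  where "Cay A X = \<lparr>verts = carrier A,
    edges = {{g, g \<otimes>\<^bsub>A\<^esub> x} | g x. g \<in> carrier A \<and> x \<in> X}\<rparr>"

definition typical_covering ::
    "('a, 'm) monoid_scheme \<Rightarrow> 'a set \<Rightarrow> ('a \<Rightarrow> 'b) \<Rightarrow> ('b, 'n) monoid_scheme \<Rightarrow> 'b set \<Rightarrow> bool"
  where "typical_covering A X f B Y \<longleftrightarrow>
    comm_group A \<and> finite (carrier A) \<and> cayley_subset A X \<and>
    f \<in> epi A B \<and> f ` X = Y \<and> X \<inter> kernel A B f = {} \<and> bij_betw f X Y \<and>
    graph_covering f (Cay A X) (Cay B Y)"

text \<open>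
  The typical coverings whose total space is a Cayley graph of a group with elements in the
  type \<open>'u\<close>. If \<open>'u\<close> is infinite, every finite group has an isomorphic copy with elements
  in \<open>'u\<close>, so that every isomorphism class of coverings is represented.
\<close>

definition typical_coverings ::
    "('b, 'n) monoid_scheme \<Rightarrow> 'b set \<Rightarrow> ('c, 'm) monoid_scheme \<Rightarrow> ('d, 'k) monoid_scheme \<Rightarrow>
     ('u monoid \<times> 'u set \<times> ('u \<Rightarrow> 'b)) set"
  where "typical_coverings B Y A0 F =
    {(A, X, f). typical_covering A X f B Y \<and> A \<cong> A0 \<and> A\<lparr>carrier := kernel A B f\<rparr> \<cong> F}"

definition covering_equiv ::
    "('u monoid \<times> 'u set \<times> ('u \<Rightarrow> 'b)) set \<Rightarrow>
     (('u monoid \<times> 'u set \<times> ('u \<Rightarrow> 'b)) \<times> ('u monoid \<times> 'u set \<times> ('u \<Rightarrow> 'b))) set"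
  where "covering_equiv C =
    {((A1, X1, f1), (A2, X2, f2)). (A1, X1, f1) \<in> C \<and> (A2, X2, f2) \<in> C \<and>
       isomorphic_coverings (Cay A1 X1) f1 (Cay A2 X2) f2}"

definition covering_classes ::
    "('b, 'n) monoid_scheme \<Rightarrow> 'b set \<Rightarrow> ('c, 'm) monoid_scheme \<Rightarrow> ('d, 'k) monoid_scheme \<Rightarrow>
     ('u monoid \<times> 'u set \<times> ('u \<Rightarrow> 'b)) set set"
  where "covering_classes B Y A0 F =
    typical_coverings B Y A0 F // covering_equiv (typical_coverings B Y A0 F)"

text \<open>
  The generators are indexed as \<open>y 1, ..., y l\<close> and \<open>y' 1, ..., y' l'\<close>; the values of
  \<open>y\<close> and \<open>y'\<close> at other indices are irrelevant.
\<close>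

definition generator_listing ::
    "('b, 'n) monoid_scheme \<Rightarrow> 'b set \<Rightarrow> nat \<Rightarrow> nat \<Rightarrow> (nat \<Rightarrow> 'b) \<Rightarrow> (nat \<Rightarrow> 'b) \<Rightarrow> bool"
  where "generator_listing B Y l l' y y' \<longleftrightarrow>
    Y = y ` {1..l} \<union> (\<lambda>i. inv\<^bsub>B\<^esub> y i) ` {1..l} \<union> y' ` {1..l'} \<and>
    (\<forall>i \<in> {1..l}. y i \<otimes>\<^bsub>B\<^esub> y i \<noteq> \<one>\<^bsub>B\<^esub>) \<and>
    (\<forall>j \<in> {1..l'}. y' j \<otimes>\<^bsub>B\<^esub> y' j = \<one>\<^bsub>B\<^esub>) \<and>
    distinct (map y [1..<Suc l] @ map (\<lambda>i. inv\<^bsub>B\<^esub> y i) [1..<Suc l] @ map y' [1..<Suc l'])"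

definition group_exp :: "('a, 'm) monoid_scheme \<Rightarrow> nat"
  where "group_exp A = (LEAST s. 0 < s \<and> (\<forall>a \<in> carrier A. a [^]\<^bsub>A\<^esub> s = \<one>\<^bsub>A\<^esub>))"

text \<open>
  The group \<open>\<int>\<^sup>n\<close>; its elements are the functions \<open>nat \<Rightarrow> int\<close> that are
  \<open>undefined\<close> outside \<open>{1..n}\<close>.
\<close>

definition int_lattice :: "nat \<Rightarrow> (nat \<Rightarrow> int) monoid"
  where "int_lattice n = product_group {1..n} (\<lambda>_. integer_group)"

definition relation_lattice ::
    "('b, 'n) monoid_scheme \<Rightarrow> nat \<Rightarrow> nat \<Rightarrow> (nat \<Rightarrow> 'b) \<Rightarrow> (nat \<Rightarrow> 'b) \<Rightarrow> (nat \<Rightarrow> int) set"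
  where "relation_lattice B l l' y y' =
    {a \<in> carrier (int_lattice (l + l')).
       (\<Otimes>\<^bsub>B\<^esub>i \<in> {1..l}. y i [^]\<^bsub>B\<^esub> a i) \<otimes>\<^bsub>B\<^esub>
       (\<Otimes>\<^bsub>B\<^esub>j \<in> {1..l'}. y' j [^]\<^bsub>B\<^esub> a (l + j)) = \<one>\<^bsub>B\<^esub>}"

definition involution_lattice :: "nat \<Rightarrow> nat \<Rightarrow> (nat \<Rightarrow> int) set"
  where "involution_lattice l l' =
    {a \<in> carrier (int_lattice (l + l')).
       (\<forall>i \<in> {1..l}. a i = 0) \<and> (\<forall>j \<in> {1..l'}. 2 dvd a (l + j))}"

definition multiples_lattice :: "nat \<Rightarrow> nat \<Rightarrow> (nat \<Rightarrow> int) set"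
  where "multiples_lattice n m = {a \<in> carrier (int_lattice n). \<forall>i \<in> {1..n}. int m dvd a i}"

text \<open>
  For \<open>N \<le> H \<le> G\<close>, the carrier of \<open>H / N\<close>, whose elements are cosets of \<open>N\<close>
  and hence elements of \<open>G / N\<close>.
\<close>

definition quotient_subset :: "('a, 'm) monoid_scheme \<Rightarrow> 'a set \<Rightarrow> 'a set \<Rightarrow> 'a set set"
  where "quotient_subset G H N = carrier ((G\<lparr>carrier := H\<rparr>) Mod N)"

end

theory Submission
  imports Defs "HOL-Algebra.Multiplicative_Group"
begin

text \<open>
  Let \<open>Q = \<int>\<^sup>n / R\<close>. A typical covering \<open>(A, X, f)\<close> with the prescribed kernel has
  \<open>exp A\<close> dividing \<open>exp B * exp F\<close>, so sending the basis vectors to the unique lifts to \<open>X\<close>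
  of the chosen generators of \<open>B\<close> defines an epimorphism \<open>\<phi> : Q \<rightarrow> A\<close> over \<open>B\<close>, and the
  covering corresponds to \<open>D = ker \<phi>\<close>. Unique lifting of edges shows that a graph isomorphism
  \<open>\<Phi>\<close> over \<open>Cay(B, Y)\<close> satisfies \<open>\<Phi>(u + \<phi>\<^sub>1 x) = \<Phi>(u) + \<phi>\<^sub>2 x\<close>; hence \<open>\<phi>\<^sub>1\<close> and \<open>\<phi>\<^sub>2\<close> have
  the same kernel. Conversely \<open>D\<close> is realised by \<open>Q / D\<close>: since \<open>D\<close>
  contains \<open>R\<^sub>0\<close>, the image of the basis vector of an involution is its own inverse, which makes
  \<open>X \<rightarrow> Y\<close> injective.
\<close>

section \<open>Cayley graphs and their coverings\<close>

text \<open>Edges are unordered pairs. Since \<open>X\<close> is closed under inversion, reading an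
  edge from either end gives the same condition, so one quotient decides adjacency.\<close>

lemma edge_Cay_iff:
  assumes "group A" "cayley_subset A X" "u \<in> carrier A" "v \<in> carrier A"
  shows "{u, v} \<in> edges (Cay A X) \<longleftrightarrow> inv\<^bsub>A\<^esub> u \<otimes>\<^bsub>A\<^esub> v \<in> X"
proof
  interpret group A by fact
  have X: "X \<subseteq> carrier A" "m_inv A ` X = X"
    using assms(2) by (auto simp: cayley_subset_def)
  assume "{u, v} \<in> edges (Cay A X)"
  then obtain g x where gx: "{u, v} = {g, g \<otimes>\<^bsub>A\<^esub> x}" "g \<in> carrier A" "x \<in> X"
    by (auto simp: Cay_def)
  have x: "x \<in> carrier A" using gx X by auto
  from gx(1) consider "u = g" "v = g \<otimes>\<^bsub>A\<^esub> x" | "v = g" "u = g \<otimes>\<^bsub>A\<^esub> x"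
    by (auto simp: doubleton_eq_iff)
  then show "inv\<^bsub>A\<^esub> u \<otimes>\<^bsub>A\<^esub> v \<in> X"
  proof cases
    case 1
    then show ?thesis using gx x by (simp flip: m_assoc)
  next
    case 2
    then have "inv\<^bsub>A\<^esub> u \<otimes>\<^bsub>A\<^esub> v = inv\<^bsub>A\<^esub> x"
      using gx x by (simp add: inv_mult_group m_assoc)
    then show ?thesis using gx X by blast
  qed
next
  interpret group A by fact
  assume "inv\<^bsub>A\<^esub> u \<otimes>\<^bsub>A\<^esub> v \<in> X"
  moreover have "v = u \<otimes>\<^bsub>A\<^esub> (inv\<^bsub>A\<^esub> u \<otimes>\<^bsub>A\<^esub> v)"
    using assms by (simp flip: m_assoc)
  ultimately show "{u, v} \<in> edges (Cay A X)"
    using assms(3) unfolding Cay_def by (simp, metis)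
qed

lemma verts_Cay: "verts (Cay A X) = carrier A"
  by (simp add: Cay_def)

lemma neighbours_Cay:
  assumes "group A" "cayley_subset A X" "v \<in> carrier A"
  shows "neighbours (Cay A X) v = (\<otimes>\<^bsub>A\<^esub>) v ` X"
proof -
  interpret group A by fact
  have X: "X \<subseteq> carrier A" using assms(2) by (auto simp: cayley_subset_def)
  have "u \<in> (\<otimes>\<^bsub>A\<^esub>) v ` X \<longleftrightarrow> u \<in> carrier A \<and> inv\<^bsub>A\<^esub> v \<otimes>\<^bsub>A\<^esub> u \<in> X" for u
  proof
    assume "u \<in> (\<otimes>\<^bsub>A\<^esub>) v ` X"
    then obtain x where "x \<in> X" "u = v \<otimes>\<^bsub>A\<^esub> x" by auto
    then show "u \<in> carrier A \<and> inv\<^bsub>A\<^esub> v \<otimes>\<^bsub>A\<^esub> u \<in> X"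
      using X assms by (auto simp flip: m_assoc)
  next
    assume u: "u \<in> carrier A \<and> inv\<^bsub>A\<^esub> v \<otimes>\<^bsub>A\<^esub> u \<in> X"
    then have "u = v \<otimes>\<^bsub>A\<^esub> (inv\<^bsub>A\<^esub> v \<otimes>\<^bsub>A\<^esub> u)"
      using assms by (simp flip: m_assoc)
    then show "u \<in> (\<otimes>\<^bsub>A\<^esub>) v ` X" using u by blast
  qed
  then show ?thesis
    using edge_Cay_iff[OF assms(1-3)] verts_Cay[of A X] unfolding neighbours_def set_eq_iff by auto
qed

lemma connected_Cay_iff:
  assumes "group A" "cayley_subset A X"
  shows "connected_graph (Cay A X) \<longleftrightarrow> generate A X = carrier A"
proof -
  interpret group A by fact
  have X: "X \<subseteq> carrier A" "\<And>x. x \<in> X \<Longrightarrow> inv\<^bsub>A\<^esub> x \<in> X"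
    using assms(2) by (auto simp: cayley_subset_def)
  define E where "E = {(a, b). {a, b} \<in> edges (Cay A X)}"
  have gc: "generate A X \<subseteq> carrier A" using X generate_incl by simp
  have E_mult: "(u, u \<otimes>\<^bsub>A\<^esub> x) \<in> E" if "u \<in> carrier A" "x \<in> X" for u x
    using that by (auto simp: E_def Cay_def)
  \<comment> \<open>The start vertex is quantified inside the induction: for a product
    \<open>g h\<close>, the walk for \<open>h\<close> starts at \<open>u g\<close> and not at
    \<open>u\<close>.\<close>
  have reach: "\<forall>u \<in> carrier A. (u, u \<otimes>\<^bsub>A\<^esub> g) \<in> E\<^sup>*" if "g \<in> generate A X" for g
    using that
  proof induction
    case (eng g h)
    show ?case
    proof
      fix u assume u: "u \<in> carrier A"
      have gh: "g \<in> carrier A" "h \<in> carrier A" using eng gc by auto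
      have "(u, u \<otimes>\<^bsub>A\<^esub> g) \<in> E\<^sup>*" "(u \<otimes>\<^bsub>A\<^esub> g, u \<otimes>\<^bsub>A\<^esub> g \<otimes>\<^bsub>A\<^esub> h) \<in> E\<^sup>*"
        using eng gh u by auto
      then show "(u, u \<otimes>\<^bsub>A\<^esub> (g \<otimes>\<^bsub>A\<^esub> h)) \<in> E\<^sup>*"
        using gh u by (simp add: m_assoc)
    qed
  qed (use E_mult X in auto)
  have walk: "v \<in> carrier A \<and> inv\<^bsub>A\<^esub> u \<otimes>\<^bsub>A\<^esub> v \<in> generate A X"
    if "(u, v) \<in> E\<^sup>*" "u \<in> carrier A" for u v
    using that
  proof (induction rule: rtrancl_induct)
    case base
    then show ?case by (simp add: generate.one)
  next
    case (step v w)
    have w: "w \<in> carrier A"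
      using step(2) X by (auto simp: E_def Cay_def doubleton_eq_iff)
    have "inv\<^bsub>A\<^esub> v \<otimes>\<^bsub>A\<^esub> w \<in> X"
      using step w edge_Cay_iff[OF assms] by (auto simp: E_def)
    then have "(inv\<^bsub>A\<^esub> u \<otimes>\<^bsub>A\<^esub> v) \<otimes>\<^bsub>A\<^esub> (inv\<^bsub>A\<^esub> v \<otimes>\<^bsub>A\<^esub> w) \<in> generate A X"
      using step by (blast intro: generate.intros)
    moreover have "(inv\<^bsub>A\<^esub> u \<otimes>\<^bsub>A\<^esub> v) \<otimes>\<^bsub>A\<^esub> (inv\<^bsub>A\<^esub> v \<otimes>\<^bsub>A\<^esub> w) = inv\<^bsub>A\<^esub> u \<otimes>\<^bsub>A\<^esub> w"
      using step w by (metis inv_closed inv_solve_left m_assoc m_closed)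
    ultimately show ?case using w by simp
  qed
  have conn: "connected_graph (Cay A X) \<longleftrightarrow> (\<forall>u \<in> carrier A. \<forall>v \<in> carrier A. (u, v) \<in> E\<^sup>*)"
    by (auto simp: connected_graph_def E_def Cay_def)
  show ?thesis
  proof
    assume "connected_graph (Cay A X)"
    then have "v \<in> generate A X" if "v \<in> carrier A" for v
      using that walk[of "\<one>\<^bsub>A\<^esub>" v] conn by simp
    then show "generate A X = carrier A" using gc by blast
  next
    assume gen: "generate A X = carrier A"
    have "(u, v) \<in> E\<^sup>*" if "u \<in> carrier A" "v \<in> carrier A" for u v
    proof -
      have "(u, u \<otimes>\<^bsub>A\<^esub> (inv\<^bsub>A\<^esub> u \<otimes>\<^bsub>A\<^esub> v)) \<in> E\<^sup>*"
        using that gen reach by simp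
      then show ?thesis using that by (simp flip: m_assoc)
    qed
    then show "connected_graph (Cay A X)" using conn by blast
  qed
qed

lemma finite_simple_connected_Cay:
  assumes "group A" "cayley_subset A X" "finite (carrier A)" "generate A X = carrier A"
  shows "finite_simple_connected (Cay A X)"
proof -
  interpret group A by fact
  have "e \<subseteq> carrier A \<and> card e = 2" if e: "e \<in> edges (Cay A X)" for e
  proof -
    obtain g x where gx: "e = {g, g \<otimes>\<^bsub>A\<^esub> x}" "g \<in> carrier A" "x \<in> X"
      using e by (auto simp: Cay_def)
    then have "x \<in> carrier A" "x \<noteq> \<one>\<^bsub>A\<^esub>" using assms(2) by (auto simp: cayley_subset_def)
    then show ?thesis using gx by (auto simp: card_2_iff)
  qed
  then show ?thesis
    using assms connected_Cay_iff[OF assms(1,2)]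
    by (auto simp: finite_simple_connected_def Cay_def)
qed

text \<open>The neighbourhoods of \<open>v\<close> and \<open>f v\<close> are the translates of
  \<open>X\<close> and \<open>Y\<close>, and \<open>f\<close> turns translation by \<open>v\<close>
  into translation by \<open>f v\<close>. Bijectivity of \<open>X\<close> onto \<open>Y\<close>
  therefore gives the local condition at every vertex.\<close>

lemma graph_covering_Cay:
  assumes "group A" "cayley_subset A X" "finite (carrier A)" "generate A X = carrier A"
    and "group B" "cayley_subset B Y" "finite (carrier B)" "generate B Y = carrier B"
    and f: "f \<in> epi A B" and XY: "bij_betw f X Y"
  shows "graph_covering f (Cay A X) (Cay B Y)"
proof -
  interpret A: group A by fact
  interpret B: group B by fact
  have fh: "f \<in> hom A B" and fs: "f ` carrier A = carrier B" using f by (auto simp: epi_def)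
  have X: "X \<subseteq> carrier A" and Y: "Y \<subseteq> carrier B" using assms by (auto simp: cayley_subset_def)
  have "bij_betw f (neighbours (Cay A X) v) (neighbours (Cay B Y) (f v))" if v: "v \<in> carrier A" for v
  proof -
    have fv: "f v \<in> carrier B" using v fs by blast
    have eq: "f (v \<otimes>\<^bsub>A\<^esub> x) = f v \<otimes>\<^bsub>B\<^esub> f x" if "x \<in> X" for x
      using fh v X that by (auto simp: hom_def)
    have "inj_on f ((\<otimes>\<^bsub>A\<^esub>) v ` X)"
    proof (rule inj_onI, clarsimp)
      fix x x' assume *: "x \<in> X" "x' \<in> X" "f (v \<otimes>\<^bsub>A\<^esub> x) = f (v \<otimes>\<^bsub>A\<^esub> x')"
      have "f x \<in> carrier B" "f x' \<in> carrier B" using * X fs by blast+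
      then have "f x = f x'" using * eq fv by simp
      then show "v \<otimes>\<^bsub>A\<^esub> x = v \<otimes>\<^bsub>A\<^esub> x'" using * XY by (auto simp: bij_betw_def inj_on_def)
    qed
    moreover have "f ` (\<otimes>\<^bsub>A\<^esub>) v ` X = (\<otimes>\<^bsub>B\<^esub>) (f v) ` Y"
      using eq XY by (auto simp: bij_betw_def image_image)
    ultimately show ?thesis
      using neighbours_Cay[OF assms(1,2) v] neighbours_Cay[OF assms(5,6) fv]
      by (simp add: bij_betw_def)
  qed
  then show ?thesis
    using finite_simple_connected_Cay[OF assms(1-4)] finite_simple_connected_Cay[OF assms(5-8)] fs
    by (auto simp: graph_covering_def Cay_def)
qed

section \<open>Coverings below a marked group\<close>

lemma (in group_hom) eq_iff_kernel:
  assumes "x \<in> carrier G" "y \<in> carrier G"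
  shows "h x = h y \<longleftrightarrow> x \<otimes>\<^bsub>G\<^esub> inv\<^bsub>G\<^esub> y \<in> kernel G H h"
proof -
  have "h (x \<otimes>\<^bsub>G\<^esub> inv\<^bsub>G\<^esub> y) = h x \<otimes>\<^bsub>H\<^esub> inv\<^bsub>H\<^esub> h y"
    using assms by simp
  moreover have "h x \<otimes>\<^bsub>H\<^esub> inv\<^bsub>H\<^esub> h y = \<one>\<^bsub>H\<^esub> \<longleftrightarrow> h x = h y"
    using assms H.right_cancel[of "inv\<^bsub>H\<^esub> h y" "h x" "h y"] by simp
  ultimately show ?thesis using assms by (auto simp: kernel_def)
qed

text \<open>The kernel inclusion makes \<open>\<psi> x\<close> depend only on
  \<open>\<phi> x\<close>, so an arbitrary choice of preimages defines a homomorphism. This serves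
  both to build the projection of a covering and to compare two coverings.\<close>

lemma hom_factors_through_surjection:
  assumes "group_hom Q A \<phi>" "\<phi> ` carrier Q = carrier A" "group_hom Q B \<psi>"
    and ker: "kernel Q A \<phi> \<subseteq> kernel Q B \<psi>"
  obtains f where "f \<in> hom A B" "\<And>x. x \<in> carrier Q \<Longrightarrow> f (\<phi> x) = \<psi> x"
proof -
  interpret \<phi>: group_hom Q A \<phi> by fact
  interpret \<psi>: group_hom Q B \<psi> by fact
  define f where "f = \<psi> \<circ> inv_into (carrier Q) \<phi>"
  have f: "f (\<phi> x) = \<psi> x" if "x \<in> carrier Q" for x
  proof -
    let ?x = "inv_into (carrier Q) \<phi> (\<phi> x)"
    have "?x \<in> carrier Q" "\<phi> ?x = \<phi> x"
      using that by (auto intro: inv_into_into f_inv_into_f)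
    then show ?thesis
      using that ker \<phi>.eq_iff_kernel[of ?x x] \<psi>.eq_iff_kernel[of ?x x] by (auto simp: f_def)
  qed
  have "f \<in> hom A B"
  proof (rule homI)
    fix a assume "a \<in> carrier A"
    then obtain x where "x \<in> carrier Q" "a = \<phi> x" using assms(2) by blast
    then show "f a \<in> carrier B" by (simp add: f)
  next
    fix a b assume "a \<in> carrier A" "b \<in> carrier A"
    then obtain x y where x: "x \<in> carrier Q" "a = \<phi> x" and y: "y \<in> carrier Q" "b = \<phi> y"
      using assms(2) by blast
    then have "f (a \<otimes>\<^bsub>A\<^esub> b) = f (\<phi> (x \<otimes>\<^bsub>Q\<^esub> y))" by simp
    also have "\<dots> = \<psi> (x \<otimes>\<^bsub>Q\<^esub> y)" using x y by (intro f) simp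
    also have "\<dots> = f a \<otimes>\<^bsub>B\<^esub> f b" using x y by (simp add: f)
    finally show "f (a \<otimes>\<^bsub>A\<^esub> b) = f a \<otimes>\<^bsub>B\<^esub> f b" .
  qed
  with f that show thesis by blast
qed

text \<open>
  In the application \<open>Q\<close> is \<open>\<int>\<^sup>n / R\<close>, the marking \<open>q\<close> lists the images of the standard
  basis, \<open>\<psi>\<close> sends them to the chosen generators of \<open>B\<close>, and \<open>J\<close> indexes the
  involutions among these.
\<close>

locale marked_group = group_hom Q B \<psi>
  for Q :: "'q monoid" and B :: "'b monoid" and \<psi> :: "'q \<Rightarrow> 'b" +
  fixes I J :: "'i set" and q :: "'i \<Rightarrow> 'q" and Y :: "'b set"
  assumes Q_comm: "comm_group Q"
    and B_finite: "finite (carrier B)"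
    and q_closed: "q ` I \<subseteq> carrier Q"
    and q_generate: "generate Q (q ` I) = carrier Q"
    and Y_cayley: "cayley_subset B Y"
    and Y_connected: "connected_graph (Cay B Y)"
    and Y_eq: "Y = \<psi> ` q ` I \<union> (\<lambda>i. inv\<^bsub>B\<^esub> \<psi> (q i)) ` I"
    and \<psi>_inj: "inj_on (\<psi> \<circ> q) I"
    and \<psi>_inv: "\<lbrakk>i \<in> I; k \<in> I; \<psi> (q i) = inv\<^bsub>B\<^esub> \<psi> (q k)\<rbrakk> \<Longrightarrow> i = k \<and> i \<in> J"
    and J: "J \<subseteq> I" "i \<in> J \<Longrightarrow> \<psi> (q i) = inv\<^bsub>B\<^esub> \<psi> (q i)"
begin

text \<open>For a typical covering, injectivity of \<open>f\<close> on \<open>X\<close> fixes every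
  \<open>\<phi> (q i)\<close>, and the \<open>q i\<close> generate \<open>Q\<close>. Hence such a
  \<open>\<phi>\<close> is unique on the carrier of \<open>Q\<close>, and its kernel is an invariant
  of the covering.\<close>

definition lifts :: "('a, 'm) monoid_scheme \<Rightarrow> 'a set \<Rightarrow> ('a \<Rightarrow> 'b) \<Rightarrow> ('q \<Rightarrow> 'a) \<Rightarrow> bool"
  where "lifts A X f \<phi> \<longleftrightarrow> \<phi> \<in> hom Q A \<and> (\<forall>i \<in> I. \<phi> (q i) \<in> X \<and> f (\<phi> (q i)) = \<psi> (q i))"

text \<open>The symmetric closure of the marking, whose images are all of \<open>Y\<close> and,
  under a lift, all of \<open>X\<close>. The map \<open>\<psi>\<close> need not be injective on it:
  \<open>q j\<close> and its inverse have the same image when \<open>j\<close> is in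
  \<open>J\<close>.\<close>

definition gens :: "'q set"
  where "gens = q ` I \<union> (\<lambda>i. inv\<^bsub>Q\<^esub> q i) ` I"

lemma gens_closed: "gens \<subseteq> carrier Q"
  using q_closed by (auto simp: gens_def)

lemma \<psi>_gens: "\<psi> ` gens = Y"
proof -
  have "\<psi> (inv\<^bsub>Q\<^esub> q i) = inv\<^bsub>B\<^esub> \<psi> (q i)" if "i \<in> I" for i
    using that q_closed by (intro hom_inv) auto
  then have "(\<lambda>i. \<psi> (inv\<^bsub>Q\<^esub> q i)) ` I = (\<lambda>i. inv\<^bsub>B\<^esub> \<psi> (q i)) ` I"
    by (intro image_cong) auto
  then show ?thesis by (simp add: Y_eq gens_def image_Un image_image)
qed

lemma Y_generate: "generate B Y = carrier B"
  using Y_connected connected_Cay_iff[OF _ Y_cayley] by simp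

lemma \<psi>_surj: "\<psi> ` carrier Q = carrier B"
proof -
  have "generate B Y \<subseteq> \<psi> ` carrier Q"
  proof (rule H.generate_subgroup_incl)
    show "Y \<subseteq> \<psi> ` carrier Q" using \<psi>_gens gens_closed by blast
    show "subgroup (\<psi> ` carrier Q) B" by (rule img_is_subgroup)
  qed
  then show ?thesis using Y_generate by auto
qed

lemma generate_induct [consumes 1, case_names one gen inv mult]:
  assumes "x \<in> carrier Q" "P \<one>\<^bsub>Q\<^esub>" "\<And>i. i \<in> I \<Longrightarrow> P (q i)" "\<And>i. i \<in> I \<Longrightarrow> P (inv\<^bsub>Q\<^esub> q i)"
    and "\<And>x y. \<lbrakk>x \<in> carrier Q; y \<in> carrier Q; P x; P y\<rbrakk> \<Longrightarrow> P (x \<otimes>\<^bsub>Q\<^esub> y)"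
  shows "P x"
proof -
  have "x \<in> generate Q (q ` I)" using assms(1) q_generate by simp
  then show ?thesis
  proof induction
    case (eng x y)
    then show ?case using assms(5)[of x y] q_generate by simp
  qed (use assms in auto)
qed

section \<open>Lifts of the marking along a typical covering\<close>

context
  fixes A :: "('a, 'm) monoid_scheme" and X f \<phi>
  assumes cov: "typical_covering A X f B Y" and lift: "lifts A X f \<phi>"
begin

lemma lift_groups: "group_hom Q A \<phi>" "group_hom A B f" "cayley_subset A X"
  "inj_on f X" "generate A X = carrier A" "f ` X = Y"
proof -
  have A: "group A" "cayley_subset A X"
    using cov by (auto simp: typical_covering_def comm_group.axioms(2))
  moreover have "connected_graph (Cay A X)"
    using cov by (simp add: typical_covering_def graph_covering_def finite_simple_connected_def)
  ultimately show "generate A X = carrier A" using connected_Cay_iff by blast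
  show "group_hom Q A \<phi>" "group_hom A B f" "cayley_subset A X" "inj_on f X" "f ` X = Y"
    using A cov lift
    by (auto simp: group_hom_def group_hom_axioms_def lifts_def typical_covering_def epi_def bij_betw_def)
qed

interpretation \<phi>: group_hom Q A \<phi> by (rule lift_groups)
interpretation f: group_hom A B f by (rule lift_groups)

lemma lift_gens: "i \<in> I \<Longrightarrow> \<phi> (q i) \<in> X" "i \<in> I \<Longrightarrow> \<phi> (inv\<^bsub>Q\<^esub> q i) \<in> X"
proof -
  assume i: "i \<in> I"
  then show "\<phi> (q i) \<in> X" using lift by (simp add: lifts_def)
  then have "inv\<^bsub>A\<^esub> \<phi> (q i) \<in> X" using lift_groups(3) by (auto simp: cayley_subset_def)
  then show "\<phi> (inv\<^bsub>Q\<^esub> q i) \<in> X" using i q_closed by (simp add: image_subset_iff)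
qed

text \<open>A lift is compatible with \<open>\<psi>\<close> on the marking by definition;
  homomorphisms that agree on generators agree everywhere.\<close>

lemma lift_over: "x \<in> carrier Q \<Longrightarrow> f (\<phi> x) = \<psi> x"
proof (induction x rule: generate_induct)
  case (gen i)
  then show ?case using lift by (simp add: lifts_def)
next
  case (inv i)
  then show ?case using lift q_closed by (simp add: lifts_def image_subset_iff)
qed auto

text \<open>A point of \<open>X\<close> lies over the same element of \<open>Y\<close> as the image
  of some member of \<open>gens\<close>. Both are in \<open>X\<close>, where \<open>f\<close> is
  injective, so they coincide. Thus \<open>\<phi>\<close> determines the connection set.\<close>

lemma lift_image_gens: "\<phi> ` gens = X"
proof
  show "\<phi> ` gens \<subseteq> X" using lift_gens by (auto simp: gens_def)
  show "X \<subseteq> \<phi> ` gens"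
  proof
    fix x assume x: "x \<in> X"
    then obtain g where g: "g \<in> gens" "f x = \<psi> g" using lift_groups(6) \<psi>_gens by blast
    then have "\<phi> g \<in> X" "f (\<phi> g) = f x"
      using lift_gens lift_over gens_closed by (auto simp: gens_def)
    then have "x = \<phi> g" using lift_groups(4) x by (auto dest: inj_onD)
    then show "x \<in> \<phi> ` gens" using g by blast
  qed
qed

lemma lift_surj: "\<phi> ` carrier Q = carrier A"
proof -
  have "generate A X \<subseteq> \<phi> ` carrier Q"
  proof (rule \<phi>.H.generate_subgroup_incl)
    show "X \<subseteq> \<phi> ` carrier Q" using lift_image_gens gens_closed by blast
    show "subgroup (\<phi> ` carrier Q) A" by (rule \<phi>.img_is_subgroup)
  qed
  then show ?thesis using lift_groups(5) by auto
qed

lemma lift_kernel_le: "kernel Q A \<phi> \<subseteq> kernel Q B \<psi>"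
  using lift_over by (force simp: kernel_def)

text \<open>This is the necessity of the condition that \<open>D\<close> contains the involution
  lattice. Over an involution of \<open>B\<close> lie both \<open>\<phi> (q j)\<close> and its
  inverse; both are in \<open>X\<close>, so injectivity of \<open>f\<close> on \<open>X\<close>
  makes them equal.\<close>

lemma lift_square:
  assumes "j \<in> J"
  shows "q j \<otimes>\<^bsub>Q\<^esub> q j \<in> kernel Q A \<phi>"
proof -
  have j: "j \<in> I" "q j \<in> carrier Q" using assms J q_closed by auto
  then have "f (\<phi> (inv\<^bsub>Q\<^esub> q j)) = f (\<phi> (q j))"
    using J(2)[OF assms] lift_over[of "q j"] lift_over[of "inv\<^bsub>Q\<^esub> q j"] by simp
  then have "\<phi> (inv\<^bsub>Q\<^esub> q j) = \<phi> (q j)"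
    using lift_gens[OF j(1)] lift_groups(4) by (auto dest: inj_onD)
  then have "\<phi> (q j) \<otimes>\<^bsub>A\<^esub> \<phi> (q j) = \<one>\<^bsub>A\<^esub>" using j by (metis \<phi>.hom_closed \<phi>.hom_inv \<phi>.H.r_inv)
  then show ?thesis using j by (simp add: kernel_def)
qed

text \<open>Two uses of the first isomorphism theorem. For the second, \<open>\<phi>\<close> is
  restricted to the preimage of the kernel of \<open>f\<close>, which is the kernel of
  \<open>\<psi>\<close> because \<open>\<psi>\<close> is \<open>f\<close> after
  \<open>\<phi>\<close>.\<close>

lemma lift_quotient_iso:
  "Q Mod kernel Q A \<phi> \<cong> A"
  "Q\<lparr>carrier := kernel Q B \<psi>\<rparr> Mod kernel Q A \<phi> \<cong> A\<lparr>carrier := kernel A B f\<rparr>"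
proof -
  show "Q Mod kernel Q A \<phi> \<cong> A" by (rule \<phi>.FactGroup_iso[OF lift_surj])
  let ?K = "Q\<lparr>carrier := kernel Q B \<psi>\<rparr>" and ?L = "A\<lparr>carrier := kernel A B f\<rparr>"
  have "group ?K" "group ?L"
    by (auto intro: G.subgroup_imp_group \<phi>.H.subgroup_imp_group subgroup_kernel f.subgroup_kernel)
  moreover have "\<phi> \<in> hom ?K ?L"
    using lift_over by (auto simp: hom_def kernel_def)
  ultimately interpret K: group_hom ?K ?L \<phi>
    by (simp add: group_hom_def group_hom_axioms_def)
  have "kernel ?K ?L \<phi> = kernel Q A \<phi>"
    using lift_kernel_le by (auto simp: kernel_def)
  moreover have "\<phi> ` carrier ?K = carrier ?L"
  proof
    show "carrier ?L \<subseteq> \<phi> ` carrier ?K"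
    proof
      fix a assume "a \<in> carrier ?L"
      then have a: "a \<in> carrier A" "f a = \<one>\<^bsub>B\<^esub>" by (auto simp: kernel_def)
      then obtain x where "x \<in> carrier Q" "a = \<phi> x" using lift_surj by blast
      then show "a \<in> \<phi> ` carrier ?K" using a lift_over by (auto simp: kernel_def)
    qed
  qed (auto simp: kernel_def lift_over)
  ultimately show "?K Mod kernel Q A \<phi> \<cong> ?L" using K.FactGroup_iso by simp
qed

end

section \<open>The kernel as a complete invariant of coverings\<close>

lemma isomorphic_coverings_iff_kernel:
  assumes c1: "typical_covering A1 X1 f1 B Y" "lifts A1 X1 f1 \<phi>1"
    and c2: "typical_covering A2 X2 f2 B Y" "lifts A2 X2 f2 \<phi>2"
  shows "isomorphic_coverings (Cay A1 X1) f1 (Cay A2 X2) f2 \<longleftrightarrow>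
    kernel Q A1 \<phi>1 = kernel Q A2 \<phi>2"
proof
  interpret p1: group_hom Q A1 \<phi>1 by (rule lift_groups[OF c1])
  interpret p2: group_hom Q A2 \<phi>2 by (rule lift_groups[OF c2])
  interpret f1: group_hom A1 B f1 by (rule lift_groups[OF c1])
  interpret f2: group_hom A2 B f2 by (rule lift_groups[OF c2])
  note edge1 = edge_Cay_iff[OF p1.H.group_axioms lift_groups(3)[OF c1]]
  note edge2 = edge_Cay_iff[OF p2.H.group_axioms lift_groups(3)[OF c2]]
  {
    assume "isomorphic_coverings (Cay A1 X1) f1 (Cay A2 X2) f2"
    then obtain \<Phi> where bij: "bij_betw \<Phi> (carrier A1) (carrier A2)"
      and edge: "\<And>u v. \<lbrakk>u \<in> carrier A1; v \<in> carrier A1\<rbrakk> \<Longrightarrow>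
        {u, v} \<in> edges (Cay A1 X1) \<longleftrightarrow> {\<Phi> u, \<Phi> v} \<in> edges (Cay A2 X2)"
      and over: "\<And>v. v \<in> carrier A1 \<Longrightarrow> f2 (\<Phi> v) = f1 v"
      unfolding isomorphic_coverings_def graph_iso_def verts_Cay by blast
    have \<Phi>_closed [simp]: "\<Phi> u \<in> carrier A2" if "u \<in> carrier A1" for u
      using bij that by (auto simp: bij_betw_def)
    \<comment> \<open>Unique edge lifting: \<open>u\<close> and \<open>u \<phi>1 g\<close> are
      adjacent, so the quotient \<open>t\<close> of their images lies in \<open>X2\<close>, and it
      lies over \<open>\<psi> g\<close>. The only such element is \<open>\<phi>2 g\<close>.\<close>
    have step: "\<Phi> (u \<otimes>\<^bsub>A1\<^esub> \<phi>1 g) = \<Phi> u \<otimes>\<^bsub>A2\<^esub> \<phi>2 g" if u: "u \<in> carrier A1" and g: "g \<in> gens" for u g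
    proof -
      define t where "t = inv\<^bsub>A2\<^esub> \<Phi> u \<otimes>\<^bsub>A2\<^esub> \<Phi> (u \<otimes>\<^bsub>A1\<^esub> \<phi>1 g)"
      have gQ: "g \<in> carrier Q" using g gens_closed by blast
      have "inv\<^bsub>A1\<^esub> u \<otimes>\<^bsub>A1\<^esub> (u \<otimes>\<^bsub>A1\<^esub> \<phi>1 g) \<in> X1"
        using u gQ g lift_image_gens[OF c1] by (auto simp flip: p1.H.m_assoc)
      then have "{\<Phi> u, \<Phi> (u \<otimes>\<^bsub>A1\<^esub> \<phi>1 g)} \<in> edges (Cay A2 X2)"
        using u gQ edge edge1 by simp
      then have "t \<in> X2" using u gQ edge2 by (simp add: t_def)
      moreover have "f2 t = \<psi> g"
        using u gQ over[of u] over[of "u \<otimes>\<^bsub>A1\<^esub> \<phi>1 g"] lift_over[OF c1 gQ]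
        by (simp add: t_def flip: H.m_assoc)
      moreover have "f2 (\<phi>2 g) = \<psi> g" using lift_over[OF c2 gQ] .
      moreover have "\<phi>2 g \<in> X2" using g lift_image_gens[OF c2] by blast
      ultimately have "t = \<phi>2 g" using lift_groups(4)[OF c2] by (simp add: inj_on_def)
      then show ?thesis using u gQ by (simp add: t_def flip: p2.H.inv_solve_left')
    qed
    \<comment> \<open>The graph isomorphism is not assumed to be a homomorphism. Following a word in
      the generators edge by edge shows that it still intertwines the two translation actions of
      \<open>Q\<close>.\<close>
    have translate: "\<forall>u \<in> carrier A1. \<Phi> (u \<otimes>\<^bsub>A1\<^esub> \<phi>1 x) = \<Phi> u \<otimes>\<^bsub>A2\<^esub> \<phi>2 x" if "x \<in> carrier Q" for x
      using that
    proof (induction x rule: generate_induct)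
      case (mult x y)
      show ?case
      proof
        fix u assume u: "u \<in> carrier A1"
        have "\<Phi> (u \<otimes>\<^bsub>A1\<^esub> \<phi>1 (x \<otimes>\<^bsub>Q\<^esub> y)) = \<Phi> ((u \<otimes>\<^bsub>A1\<^esub> \<phi>1 x) \<otimes>\<^bsub>A1\<^esub> \<phi>1 y)"
          using u mult by (simp add: p1.H.m_assoc)
        also have "\<dots> = \<Phi> u \<otimes>\<^bsub>A2\<^esub> \<phi>2 (x \<otimes>\<^bsub>Q\<^esub> y)"
          using u mult by (simp add: p2.H.m_assoc)
        finally show "\<Phi> (u \<otimes>\<^bsub>A1\<^esub> \<phi>1 (x \<otimes>\<^bsub>Q\<^esub> y)) = \<Phi> u \<otimes>\<^bsub>A2\<^esub> \<phi>2 (x \<otimes>\<^bsub>Q\<^esub> y)" .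
      qed
    next
      case (gen i)
      then show ?case using step[of _ "q i"] by (simp add: gens_def)
    next
      case (inv i)
      then show ?case using step[of _ "inv\<^bsub>Q\<^esub> q i"] by (simp add: gens_def)
    qed simp
    have "\<phi>1 x = \<one>\<^bsub>A1\<^esub> \<longleftrightarrow> \<phi>2 x = \<one>\<^bsub>A2\<^esub>" if x: "x \<in> carrier Q" for x
    proof -
      \<comment> \<open>Translation is applied at the identity vertex. \<open>\<Phi>\<close> may
        move that vertex, so its image is kept as a factor and cancelled afterwards.\<close>
      have "\<Phi> (\<phi>1 x) = \<Phi> \<one>\<^bsub>A1\<^esub> \<otimes>\<^bsub>A2\<^esub> \<phi>2 x" using x translate[OF x] by force
      moreover have "\<Phi> (\<phi>1 x) = \<Phi> \<one>\<^bsub>A1\<^esub> \<longleftrightarrow> \<phi>1 x = \<one>\<^bsub>A1\<^esub>"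
        using x bij by (auto simp: bij_betw_def inj_on_eq_iff)
      moreover have "\<Phi> \<one>\<^bsub>A1\<^esub> \<otimes>\<^bsub>A2\<^esub> \<phi>2 x = \<Phi> \<one>\<^bsub>A1\<^esub> \<longleftrightarrow> \<phi>2 x = \<one>\<^bsub>A2\<^esub>"
        using x by simp
      ultimately show ?thesis by metis
    qed
    then show "kernel Q A1 \<phi>1 = kernel Q A2 \<phi>2" by (auto simp: kernel_def)
  next
    assume ker: "kernel Q A1 \<phi>1 = kernel Q A2 \<phi>2"
    \<comment> \<open>Sending \<open>\<phi>1 x\<close> to \<open>\<phi>2 x\<close> is well defined
      by one inclusion of the kernels; the other inclusion makes it injective.\<close>
    obtain \<Phi> where \<Phi>: "\<Phi> \<in> hom A1 A2" "\<And>x. x \<in> carrier Q \<Longrightarrow> \<Phi> (\<phi>1 x) = \<phi>2 x"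
      using hom_factors_through_surjection[OF p1.group_hom_axioms lift_surj[OF c1] p2.group_hom_axioms] ker
      by blast
    interpret \<Phi>: group_hom A1 A2 \<Phi> using \<Phi>(1) by unfold_locales
    have inj: "inj_on \<Phi> (carrier A1)"
    proof (rule inj_onI)
      fix a b assume ab: "a \<in> carrier A1" "b \<in> carrier A1" "\<Phi> a = \<Phi> b"
      then obtain x y where "x \<in> carrier Q" "a = \<phi>1 x" "y \<in> carrier Q" "b = \<phi>1 y"
        using lift_surj[OF c1] by blast
      then show "a = b"
        using ab \<Phi>(2) p1.eq_iff_kernel[of x y] p2.eq_iff_kernel[of x y] ker by simp
    qed
    have "\<Phi> ` \<phi>1 ` carrier Q = \<phi>2 ` carrier Q"
      unfolding image_image using \<Phi>(2) by (intro image_cong) auto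
    then have surj: "\<Phi> ` carrier A1 = carrier A2"
      using lift_surj[OF c1] lift_surj[OF c2] by simp
    have "\<Phi> ` \<phi>1 ` gens = \<phi>2 ` gens"
      unfolding image_image using \<Phi>(2) gens_closed by (intro image_cong) auto
    then have X: "\<Phi> ` X1 = X2" using lift_image_gens[OF c1] lift_image_gens[OF c2] by simp
    have X1: "X1 \<subseteq> carrier A1" using lift_groups(3)[OF c1] by (simp add: cayley_subset_def)
    have "{u, v} \<in> edges (Cay A1 X1) \<longleftrightarrow> {\<Phi> u, \<Phi> v} \<in> edges (Cay A2 X2)"
      if uv: "u \<in> carrier A1" "v \<in> carrier A1" for u v
    proof -
      let ?w = "inv\<^bsub>A1\<^esub> u \<otimes>\<^bsub>A1\<^esub> v"
      have "?w \<in> X1 \<longleftrightarrow> \<Phi> ?w \<in> \<Phi> ` X1"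
        using inj_on_image_mem_iff[OF inj _ X1, of ?w] uv by blast
      then show ?thesis using uv X edge1[OF uv] edge2[of "\<Phi> u" "\<Phi> v"] by simp
    qed
    moreover have "f2 (\<Phi> v) = f1 v" if v: "v \<in> carrier A1" for v
    proof -
      obtain x where "x \<in> carrier Q" "v = \<phi>1 x" using v lift_surj[OF c1] by blast
      then show ?thesis using \<Phi>(2) lift_over[OF c1] lift_over[OF c2] by simp
    qed
    ultimately show "isomorphic_coverings (Cay A1 X1) f1 (Cay A2 X2) f2"
      unfolding isomorphic_coverings_def graph_iso_def verts_Cay bij_betw_def
      using inj surj by blast
  }
qed

section \<open>Realising a subgroup by a covering\<close>

lemma covering_of_subgroup:
  assumes universe: "infinite (UNIV :: 'u set)"
    and D: "subgroup D Q" "D \<subseteq> kernel Q B \<psi>" "finite (carrier (Q Mod D))"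
    and sq: "\<And>j. j \<in> J \<Longrightarrow> q j \<otimes>\<^bsub>Q\<^esub> q j \<in> D"
  obtains A :: "'u monoid" and X f \<phi>
    where "typical_covering A X f B Y" "lifts A X f \<phi>" "kernel Q A \<phi> = D"
proof -
  interpret Q: comm_group Q by (rule Q_comm)
  interpret D: normal D Q by (rule Q.subgroup_imp_normal[OF D(1)])
  interpret M: comm_group "Q Mod D" by (rule Q.abelian_FactGroup[OF D(1)])
  define S where "S = carrier (Q Mod D)"
  \<comment> \<open>The elements of \<open>Q Mod D\<close> are cosets and have the wrong type. Since
    \<open>'u\<close> is infinite it contains a set of the right finite size, to which the group
    structure is carried over by the bijection \<open>h\<close>.\<close>
  obtain T :: "'u set" where "finite T" "card T = card S"
    using infinite_arbitrarily_large[OF universe] by blast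
  then obtain h where h: "bij_betw h S T"
    using D(3) finite_same_card_bij[of S T] by (auto simp: S_def)
  define A where "A = \<lparr>carrier = T, mult = (\<lambda>a b. h (inv_into S h a \<otimes>\<^bsub>Q Mod D\<^esub> inv_into S h b)),
    one = h \<one>\<^bsub>Q Mod D\<^esub>\<rparr>"
  have inv_h: "inv_into S h (h s) = s" if "s \<in> S" for s
    using that h by (simp add: bij_betw_inv_into_left)
  have "h \<in> hom (Q Mod D) A"
    using h inv_h unfolding S_def A_def by (intro homI) (auto simp: bij_betw_def simp del: mult_FactGroup)
  then have h_iso: "h \<in> iso (Q Mod D) A"
    using h by (simp add: iso_def S_def A_def)
  have "comm_group (A\<lparr>one := h \<one>\<^bsub>Q Mod D\<^esub>\<rparr>)" by (rule M.iso_imp_img_comm_group[OF h_iso])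
  then have A: "comm_group A" by (simp add: A_def)
  then interpret A: comm_group A .
  define \<phi> where "\<phi> = h \<circ> (\<lambda>x. D #>\<^bsub>Q\<^esub> x)"
  have \<phi>_hom: "\<phi> \<in> hom Q A"
    unfolding \<phi>_def using D.r_coset_hom_Mod h_iso by (auto simp: iso_def intro: Group.hom_compose)
  interpret \<phi>: group_hom Q A \<phi> using \<phi>_hom by unfold_locales
  have \<phi>_surj: "\<phi> ` carrier Q = carrier A"
    using h by (simp add: \<phi>_def A_def S_def bij_betw_def carrier_FactGroup image_comp)
  have \<phi>_ker: "kernel Q A \<phi> = D"
  proof -
    have "\<phi> x = \<one>\<^bsub>A\<^esub> \<longleftrightarrow> x \<in> D" if x: "x \<in> carrier Q" for x
    proof -
      have "D #>\<^bsub>Q\<^esub> x \<in> S" "\<one>\<^bsub>Q Mod D\<^esub> \<in> S" using x M.one_closed by (auto simp: S_def carrier_FactGroup)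
      then have "\<phi> x = \<one>\<^bsub>A\<^esub> \<longleftrightarrow> D #>\<^bsub>Q\<^esub> x = \<one>\<^bsub>Q Mod D\<^esub>"
        using h by (auto simp: \<phi>_def A_def bij_betw_def inj_on_eq_iff simp del: one_FactGroup)
      also have "\<dots> \<longleftrightarrow> x \<in> D"
        using x D(1) G.coset_join1[of D x] G.coset_join2[of x D] by (simp only: one_FactGroup) blast
      finally show ?thesis .
    qed
    then show ?thesis using D.subset by (auto simp: kernel_def)
  qed
  obtain f where f: "f \<in> hom A B" "\<And>x. x \<in> carrier Q \<Longrightarrow> f (\<phi> x) = \<psi> x"
    using hom_factors_through_surjection[OF \<phi>.group_hom_axioms \<phi>_surj group_hom_axioms] D(2) \<phi>_ker
    by blast
  interpret f: group_hom A B f using f(1) by unfold_locales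
  define X where "X = \<phi> ` gens"
  have f_surj: "f ` carrier A = carrier B"
  proof -
    have "f ` \<phi> ` carrier Q = \<psi> ` carrier Q" unfolding image_image using f(2) by (intro image_cong) auto
    then show ?thesis using \<phi>_surj \<psi>_surj by simp
  qed
  have f_X: "f ` X = Y"
  proof -
    have "f ` \<phi> ` gens = \<psi> ` gens" unfolding image_image using f(2) gens_closed by (intro image_cong) auto
    then show ?thesis using \<psi>_gens by (simp add: X_def)
  qed
  have qi: "q i \<in> carrier Q" if "i \<in> I" for i using that q_closed by auto
  \<comment> \<open>Here the squares in \<open>D\<close> are used: they make the image of an
    involution generator its own inverse in \<open>A\<close>.\<close>
  have \<phi>_invol: "\<phi> (inv\<^bsub>Q\<^esub> q j) = \<phi> (q j)" if "j \<in> J" for j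
  proof -
    have "j \<in> I" using that J(1) by blast
    have "q j \<otimes>\<^bsub>Q\<^esub> q j \<in> kernel Q A \<phi>" using sq[OF that] \<phi>_ker by blast
    then have "\<phi> (q j) \<otimes>\<^bsub>A\<^esub> \<phi> (q j) = \<one>\<^bsub>A\<^esub>"
      using qi[OF \<open>j \<in> I\<close>] by (simp add: kernel_def)
    then show ?thesis using qi[OF \<open>j \<in> I\<close>] by (simp add: A.inv_equality)
  qed
  \<comment> \<open>Injectivity of \<open>f\<close> on \<open>X\<close> means that
    \<open>\<phi>\<close> identifies members of \<open>gens\<close> whenever \<open>\<psi>\<close>
    does. For equal signs this follows from \<open>\<psi>_inj\<close>; for opposite signs
    \<open>\<psi>_inv\<close> forces a common index in \<open>J\<close>, where
    \<open>\<phi>_invol\<close> applies.\<close>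
  have inj_gens: "\<phi> g = \<phi> g'" if g: "g \<in> gens" "g' \<in> gens" "\<psi> g = \<psi> g'" for g g'
  proof -
    have same: "\<phi> (q i) = \<phi> (q k)" if "i \<in> I" "k \<in> I" "\<psi> (q i) = \<psi> (q k)" for i k
      using that \<psi>_inj by (auto simp: inj_on_def)
    have opposite: "\<phi> (q i) = \<phi> (inv\<^bsub>Q\<^esub> q k)" if "i \<in> I" "k \<in> I" "\<psi> (q i) = inv\<^bsub>B\<^esub> \<psi> (q k)" for i k
      using \<psi>_inv[OF that] \<phi>_invol[of k] by auto
    consider i k where "i \<in> I" "k \<in> I" "g = q i" "g' = q k"
      | i k where "i \<in> I" "k \<in> I" "g = q i" "g' = inv\<^bsub>Q\<^esub> q k"
      | i k where "i \<in> I" "k \<in> I" "g = inv\<^bsub>Q\<^esub> q i" "g' = q k"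
      | i k where "i \<in> I" "k \<in> I" "g = inv\<^bsub>Q\<^esub> q i" "g' = inv\<^bsub>Q\<^esub> q k"
      using g unfolding gens_def by blast
    then show ?thesis
    proof cases
      case 1
      then show ?thesis using same[of i k] g(3) by simp
    next
      case 2
      then show ?thesis using opposite[of i k] g(3) qi by simp
    next
      case 3
      then have "\<psi> (q k) = inv\<^bsub>B\<^esub> \<psi> (q i)" using g(3) qi by simp
      then show ?thesis using opposite[of k i] 3 by simp
    next
      case 4
      then have "inv\<^bsub>B\<^esub> \<psi> (q i) = inv\<^bsub>B\<^esub> \<psi> (q k)" using g(3) qi by simp
      then have "\<psi> (q i) = \<psi> (q k)" using 4 qi by (metis H.inv_inv hom_closed)
      then show ?thesis using same[of i k] 4 qi by simp
    qed
  qed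
  have f_inj: "inj_on f X"
  proof (rule inj_onI)
    fix x x' assume x: "x \<in> X" "x' \<in> X" and eq: "f x = f x'"
    obtain g g' where g: "g \<in> gens" "x = \<phi> g" "g' \<in> gens" "x' = \<phi> g'"
      using x unfolding X_def by blast
    then have "\<psi> g = \<psi> g'" using eq f(2) gens_closed by (metis subsetD)
    then show "x = x'" using inj_gens[of g g'] g by simp
  qed
  have inv_gens: "m_inv Q ` gens = gens"
  proof -
    have "m_inv Q ` gens = (\<lambda>i. inv\<^bsub>Q\<^esub> q i) ` I \<union> (\<lambda>i. inv\<^bsub>Q\<^esub> (inv\<^bsub>Q\<^esub> q i)) ` I"
      by (simp only: gens_def image_Un image_image)
    also have "(\<lambda>i. inv\<^bsub>Q\<^esub> (inv\<^bsub>Q\<^esub> q i)) ` I = q ` I" using qi by (intro image_cong) auto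
    finally show ?thesis by (simp only: gens_def Un_commute)
  qed
  have "m_inv A ` X = X"
  proof -
    have "m_inv A ` \<phi> ` gens = \<phi> ` m_inv Q ` gens"
      unfolding image_image using gens_closed by (intro image_cong) auto
    then show ?thesis using inv_gens by (simp add: X_def)
  qed
  \<comment> \<open>\<open>X\<close> lies over \<open>Y\<close>, which omits the identity of
    \<open>B\<close>. The same fact keeps the identity of \<open>A\<close> out of
    \<open>X\<close>.\<close>
  moreover have X_ker: "X \<inter> kernel A B f = {}"
    using f_X Y_cayley unfolding kernel_def cayley_subset_def by force
  moreover have "X \<subseteq> carrier A" using gens_closed \<phi>.hom_closed unfolding X_def by blast
  ultimately have X_cayley: "cayley_subset A X"
    by (auto simp: cayley_subset_def kernel_def)
  have X_generate: "generate A X = carrier A"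
  proof -
    have "\<phi> x \<in> generate A X" if "x \<in> carrier Q" for x
      using that
    proof (induction x rule: generate_induct)
      case one
      then show ?case by (simp add: generate.one)
    next
      case (gen i)
      then show ?case by (intro generate.incl) (auto simp: X_def gens_def)
    next
      case (inv i)
      then show ?case by (intro generate.incl) (auto simp: X_def gens_def)
    next
      case (mult x y)
      then show ?case by (simp add: generate.eng)
    qed
    then have "\<phi> ` carrier Q \<subseteq> generate A X" by blast
    then show ?thesis
      using \<phi>_surj A.generate_incl[of X] X_cayley by (auto simp: cayley_subset_def)
  qed
  have A_finite: "finite (carrier A)" using \<open>finite T\<close> by (simp add: A_def)
  have f_epi: "f \<in> epi A B" and f_bij: "bij_betw f X Y"
    using f(1) f_surj f_inj f_X by (auto simp: epi_def bij_betw_def)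
  have "typical_covering A X f B Y"
    unfolding typical_covering_def
    using A A_finite X_cayley f_epi f_X X_ker f_bij
      graph_covering_Cay[OF A.group_axioms X_cayley A_finite X_generate
        H.group_axioms Y_cayley B_finite Y_generate f_epi f_bij]
    by blast
  moreover have "lifts A X f \<phi>"
    unfolding lifts_def using \<phi>_hom f(2) qi by (auto simp: X_def gens_def)
  ultimately show thesis using \<phi>_ker that by blast
qed

end

section \<open>From kernels to isomorphism classes\<close>

lemma bij_betw_quotient_fibres:
  assumes "r = {(a, b). a \<in> C \<and> b \<in> C \<and> k a = k b}"
  shows "bij_betw (\<lambda>c. the_elem (k ` c)) (C // r) (k ` C)"
proof -
  have fibre: "r `` {a} = {b \<in> C. k b = k a}" if "a \<in> C" for a using assms that by auto
  \<comment> \<open>The classes are the nonempty fibres of \<open>k\<close>, so the image of a class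
    is a singleton and \<open>the_elem\<close> reads off the common value.\<close>
  have elem: "the_elem (k ` (r `` {a})) = k a" if "a \<in> C" for a
  proof -
    have "k ` (r `` {a}) = {k a}" using that fibre by auto
    then show ?thesis by simp
  qed
  have "inj_on (\<lambda>c. the_elem (k ` c)) (C // r)"
  proof (rule inj_onI)
    fix c d assume "c \<in> C // r" "d \<in> C // r" and eq: "the_elem (k ` c) = the_elem (k ` d)"
    then obtain a b where "a \<in> C" "c = r `` {a}" "b \<in> C" "d = r `` {b}" by (auto elim!: quotientE)
    then show "c = d" using eq elem fibre by auto
  qed
  moreover have "(\<lambda>c. the_elem (k ` c)) ` (C // r) = k ` C"
    using elem by (auto simp: quotient_def image_iff)
  ultimately show ?thesis by (simp add: bij_betw_def)
qed

text \<open>Once lifts exist, the kernel map separates exactly the isomorphism classes, and only its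
  range has to be identified. Existence of lifts is a hypothesis here because it depends on
  relations in \<open>Q\<close> that an arbitrary marked group need not respect.\<close>

theorem (in marked_group) ex_bij_betw_covering_classes:
  fixes A0 :: "('c, 'm) monoid_scheme" and F :: "('d, 'k) monoid_scheme"
  assumes universe: "infinite (UNIV :: 'u set)"
    and A0_finite: "finite (carrier A0)"
    and lift: "\<And>(A :: 'u monoid) X f. (A, X, f) \<in> typical_coverings B Y A0 F \<Longrightarrow> \<exists>\<phi>. lifts A X f \<phi>"
  shows "\<exists>\<delta>. bij_betw \<delta>
    (covering_classes B Y A0 F :: ('u monoid \<times> 'u set \<times> ('u \<Rightarrow> 'b)) set set)
    {D. subgroup D (Q\<lparr>carrier := kernel Q B \<psi>\<rparr>) \<and> (\<forall>j \<in> J. q j \<otimes>\<^bsub>Q\<^esub> q j \<in> D) \<and>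
        Q Mod D \<cong> A0 \<and> Q\<lparr>carrier := kernel Q B \<psi>\<rparr> Mod D \<cong> F}"
    (is "\<exists>\<delta>. bij_betw \<delta> _ ?\<D>")
proof -
  interpret Q: comm_group Q by (rule Q_comm)
  let ?K = "Q\<lparr>carrier := kernel Q B \<psi>\<rparr>"
  interpret K: group ?K by (rule G.subgroup_imp_group[OF subgroup_kernel])
  have K_comm: "comm_group ?K"
    by (rule K.group_comm_groupI) (auto simp: kernel_def Q.m_comm)
  define C where "C = (typical_coverings B Y A0 F :: ('u monoid \<times> 'u set \<times> ('u \<Rightarrow> 'b)) set)"
  \<comment> \<open>One lift is chosen for each covering, so that its kernel becomes a function
    \<open>k\<close> on \<open>C\<close>.\<close>
  obtain \<Lambda> where \<Lambda>: "lifts A X f (\<Lambda> (A, X, f))" if "(A, X, f) \<in> C" for A X f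
  proof -
    have "\<forall>c. \<exists>\<phi>. c \<in> C \<longrightarrow> (case c of (A, X, f) \<Rightarrow> lifts A X f \<phi>)"
      using lift by (auto simp: C_def)
    then show thesis using that by (metis (no_types, lifting) case_prodD)
  qed
  define k where "k c = kernel Q (fst c) (\<Lambda> c)" for c
  have cov: "typical_covering A X f B Y" if "(A, X, f) \<in> C" for A X f
    using that by (simp add: C_def typical_coverings_def)
  have "covering_equiv C = {(c, d). c \<in> C \<and> d \<in> C \<and> k c = k d}"
    unfolding covering_equiv_def
    using isomorphic_coverings_iff_kernel[OF cov \<Lambda> cov \<Lambda>] by (auto simp: k_def)
  then have "bij_betw (\<lambda>c. the_elem (k ` c)) (covering_classes B Y A0 F) (k ` C)"
    unfolding covering_classes_def C_def[symmetric] by (rule bij_betw_quotient_fibres)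
  moreover have "k ` C = ?\<D>"
  proof (intro equalityI subsetI)
    fix D assume "D \<in> k ` C"
    then obtain A X f where c: "(A, X, f) \<in> C" and D: "D = kernel Q A (\<Lambda> (A, X, f))"
      by (force simp: k_def)
    note cl = cov[OF c] \<Lambda>[OF c]
    interpret \<phi>: group_hom Q A "\<Lambda> (A, X, f)" by (rule lift_groups[OF cl])
    have "subgroup D ?K"
      unfolding D by (rule G.subgroup_incl[OF \<phi>.subgroup_kernel subgroup_kernel lift_kernel_le[OF cl]])
    moreover have "\<forall>j \<in> J. q j \<otimes>\<^bsub>Q\<^esub> q j \<in> D" unfolding D using lift_square[OF cl] by blast
    moreover have "Q Mod D \<cong> A0" "?K Mod D \<cong> F"
      using c iso_trans lift_quotient_iso[OF cl] unfolding D C_def typical_coverings_def by blast+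
    ultimately show "D \<in> ?\<D>" by blast
  next
    fix D assume D: "D \<in> ?\<D>"
    then have DK: "subgroup D ?K" by blast
    have D_sub: "subgroup D Q" using DK G.incl_subgroup subgroup_kernel by blast
    have D_ker: "D \<subseteq> kernel Q B \<psi>" using subgroup.subset[OF DK] by simp
    \<comment> \<open>Finiteness is inherited from \<open>A0\<close>; it is what lets the quotient
      be copied into \<open>'u\<close>.\<close>
    have "finite (carrier (Q Mod D))" using D A0_finite iso_finite by blast
    then obtain A :: "'u monoid" and X f \<phi> where
      cl: "typical_covering A X f B Y" "lifts A X f \<phi>" and ker: "kernel Q A \<phi> = D"
      using covering_of_subgroup[OF universe D_sub D_ker] D by blast
    have "group (Q Mod D)"
      using Q.abelian_FactGroup[OF D_sub] by (rule comm_group.axioms(2))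
    moreover have "group (?K Mod D)"
      using comm_group.abelian_FactGroup[OF K_comm DK] by (rule comm_group.axioms(2))
    ultimately have "A \<cong> Q Mod D" "A\<lparr>carrier := kernel A B f\<rparr> \<cong> ?K Mod D"
      using lift_quotient_iso[OF cl] unfolding ker by (simp_all add: group.iso_sym)
    then have "A \<cong> A0" "A\<lparr>carrier := kernel A B f\<rparr> \<cong> F"
      using D by (auto dest: iso_trans)
    then have c: "(A, X, f) \<in> C" using cl by (simp add: C_def typical_coverings_def)
    then have "k (A, X, f) = kernel Q A \<phi>"
    proof -
      \<comment> \<open>The chosen lift may differ from the constructed \<open>\<phi>\<close>. Both
        lift the same covering, which is isomorphic to itself, so their kernels agree.\<close>
      have "isomorphic_coverings (Cay A X) f (Cay A X) f"
        using isomorphic_coverings_iff_kernel[OF cl cl] by simp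
      then show ?thesis
        using isomorphic_coverings_iff_kernel[OF cl(1) \<Lambda>[OF c] cl] by (simp add: k_def)
    qed
    then show "D \<in> k ` C" using c ker by (metis image_eqI)
  qed
  ultimately show ?thesis by auto
qed

section \<open>Integer lattices\<close>

lemma group_int_lattice: "group (int_lattice n)"
  by (simp add: int_lattice_def)

lemma carrier_int_lattice: "carrier (int_lattice n) = (\<Pi>\<^sub>E i \<in> {1..n}. UNIV)"
  by (simp add: int_lattice_def)

lemma mult_int_lattice: "a \<otimes>\<^bsub>int_lattice n\<^esub> b = (\<lambda>i \<in> {1..n}. a i + b i)"
  by (simp add: int_lattice_def)

lemma one_int_lattice: "\<one>\<^bsub>int_lattice n\<^esub> = (\<lambda>i \<in> {1..n}. 0)"
  by (simp add: int_lattice_def)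

lemma inv_int_lattice:
  "a \<in> carrier (int_lattice n) \<Longrightarrow> inv\<^bsub>int_lattice n\<^esub> a = (\<lambda>i \<in> {1..n}. - a i)"
  by (simp add: int_lattice_def)

lemma comm_group_int_lattice: "comm_group (int_lattice n)"
  by (rule group.group_comm_groupI[OF group_int_lattice])
    (auto simp: mult_int_lattice add.commute)

definition unit_vector :: "nat \<Rightarrow> nat \<Rightarrow> nat \<Rightarrow> int"
  where "unit_vector n k = (\<lambda>i \<in> {1..n}. if i = k then 1 else 0)"

lemma unit_vector_closed: "unit_vector n k \<in> carrier (int_lattice n)"
  by (auto simp: unit_vector_def carrier_int_lattice)

lemma unit_vector_int_pow:
  "unit_vector n k [^]\<^bsub>int_lattice n\<^esub> (m :: int) = (\<lambda>i \<in> {1..n}. if i = k then m else 0)"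
proof
  fix i
  interpret Z: comm_group "int_lattice n" by (rule comm_group_int_lattice)
  let ?p = "unit_vector n k [^]\<^bsub>int_lattice n\<^esub> m"
  have "?p \<in> carrier (int_lattice n)" by (simp add: unit_vector_closed)
  show "?p i = (\<lambda>i \<in> {1..n}. if i = k then m else 0) i"
  proof (cases "i \<in> {1..n}")
    case True
    \<comment> \<open>The coordinate projection is a homomorphism onto the integers, where a power
      is an ordinary multiple. Outside the index range both sides are
      \<open>undefined\<close>.\<close>
    then have "(\<lambda>a. a i) \<in> hom (int_lattice n) integer_group"
      by (auto simp: hom_def mult_int_lattice)
    then have "?p i = unit_vector n k i [^]\<^bsub>integer_group\<^esub> m"
      using hom_int_pow[OF _ unit_vector_closed group_int_lattice group_integer_group] by blast
    then show ?thesis using True by (simp add: unit_vector_def)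
  next
    case False
    have "?p i = undefined"
      using \<open>?p \<in> carrier (int_lattice n)\<close> False unfolding carrier_int_lattice by (rule PiE_arb)
    then show ?thesis using False by (simp only: restrict_def if_False)
  qed
qed

text \<open>A vector is the sum of its coordinate multiples of unit vectors. The induction adds them
  one at a time through the truncations of \<open>a\<close> to its first \<open>k\<close>
  coordinates.\<close>

lemma mem_subgroup_int_lattice:
  assumes H: "subgroup H (int_lattice n)" and a: "a \<in> carrier (int_lattice n)"
    and pow: "\<And>i. i \<in> {1..n} \<Longrightarrow> unit_vector n i [^]\<^bsub>int_lattice n\<^esub> a i \<in> H"
  shows "a \<in> H"
proof -
  have "(\<lambda>i \<in> {1..n}. if i \<le> k then a i else 0) \<in> H" if "k \<le> n" for k
    using that
  proof (induction k)
    case 0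
    have "(\<lambda>i \<in> {1..n}. if i \<le> 0 then a i else 0) = \<one>\<^bsub>int_lattice n\<^esub>"
      by (auto simp: one_int_lattice)
    then show ?case using subgroup.one_closed[OF H] by simp
  next
    case (Suc k)
    have "(\<lambda>i \<in> {1..n}. if i \<le> Suc k then a i else 0) =
      (\<lambda>i \<in> {1..n}. if i \<le> k then a i else 0) \<otimes>\<^bsub>int_lattice n\<^esub>
      unit_vector n (Suc k) [^]\<^bsub>int_lattice n\<^esub> a (Suc k)"
      unfolding unit_vector_int_pow mult_int_lattice by auto
    moreover have "(\<lambda>i \<in> {1..n}. if i \<le> k then a i else 0) \<in> H"
      using Suc by (simp only: Suc_leD)
    moreover have "unit_vector n (Suc k) [^]\<^bsub>int_lattice n\<^esub> a (Suc k) \<in> H"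
      using Suc.prems by (intro pow) simp
    ultimately show ?case by (simp only: subgroup.m_closed[OF H])
  qed
  moreover have "(\<lambda>i \<in> {1..n}. if i \<le> n then a i else 0) = a"
  proof
    fix i show "(\<lambda>i \<in> {1..n}. if i \<le> n then a i else 0) i = a i"
      using a PiE_arb[of a "{1..n}" "\<lambda>_. UNIV" i] unfolding carrier_int_lattice
      by (cases "i \<in> {1..n}") auto
  qed
  ultimately show ?thesis by force
qed

lemma generate_unit_vectors:
  "generate (int_lattice n) (unit_vector n ` {1..n}) = carrier (int_lattice n)"
proof -
  interpret Z: comm_group "int_lattice n" by (rule comm_group_int_lattice)
  have sub: "unit_vector n ` {1..n} \<subseteq> carrier (int_lattice n)" using unit_vector_closed by auto
  let ?H = "generate (int_lattice n) (unit_vector n ` {1..n})"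
  have H: "subgroup ?H (int_lattice n)" by (rule Z.generate_is_subgroup[OF sub])
  have "a \<in> ?H" if "a \<in> carrier (int_lattice n)" for a
  proof (rule mem_subgroup_int_lattice[OF H that])
    fix i assume "i \<in> {1..n}"
    then have "unit_vector n i \<in> ?H" by (auto intro: generate.incl)
    then show "unit_vector n i [^]\<^bsub>int_lattice n\<^esub> a i \<in> ?H"
      using Z.subgroup_int_pow_closed[OF H] by blast
  qed
  then show ?thesis using Z.generate_incl[OF sub] by blast
qed

section \<open>Evaluation homomorphisms out of the lattice\<close>

definition lattice_eval :: "('a, 'm) monoid_scheme \<Rightarrow> nat \<Rightarrow> (nat \<Rightarrow> 'a) \<Rightarrow> (nat \<Rightarrow> int) \<Rightarrow> 'a"
  where "lattice_eval G n x a = (\<Otimes>\<^bsub>G\<^esub>i \<in> {1..n}. x i [^]\<^bsub>G\<^esub> a i)"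

context comm_group
begin

text \<open>Commutativity lets the product of sums of exponents be split. With the value on unit
  vectors, this is the universal property of the free abelian group on \<open>n\<close>
  generators.\<close>

lemma lattice_eval_hom:
  assumes x: "x \<in> {1..n} \<rightarrow> carrier G"
  shows "lattice_eval G n x \<in> hom (int_lattice n) G"
proof (rule homI)
  fix a assume "a \<in> carrier (int_lattice n)"
  show "lattice_eval G n x a \<in> carrier G"
    unfolding lattice_eval_def using x by (intro finprod_closed) auto
next
  fix a b
  have "lattice_eval G n x (a \<otimes>\<^bsub>int_lattice n\<^esub> b) = (\<Otimes>i \<in> {1..n}. x i [^] a i \<otimes> x i [^] b i)"
    unfolding lattice_eval_def using x
    by (intro finprod_cong') (auto simp: mult_int_lattice Pi_iff int_pow_mult)
  also have "\<dots> = lattice_eval G n x a \<otimes> lattice_eval G n x b"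
    unfolding lattice_eval_def using x by (intro finprod_multf) auto
  finally show "lattice_eval G n x (a \<otimes>\<^bsub>int_lattice n\<^esub> b) = lattice_eval G n x a \<otimes> lattice_eval G n x b" .
qed

lemma lattice_eval_unit_vector:
  assumes x: "x \<in> {1..n} \<rightarrow> carrier G" and k: "k \<in> {1..n}"
  shows "lattice_eval G n x (unit_vector n k) = x k"
proof -
  have "lattice_eval G n x (unit_vector n k) = (\<Otimes>i \<in> {1..n}. if k = i then x i else \<one>)"
    unfolding lattice_eval_def using x
    by (intro finprod_cong') (auto simp: unit_vector_def Pi_iff)
  also have "\<dots> = x k" by (rule finprod_singleton[OF k _ x]) simp
  finally show ?thesis .
qed

lemma lattice_eval_eq_one:
  assumes "\<And>i. i \<in> {1..n} \<Longrightarrow> x i [^] a i = \<one>"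
  shows "lattice_eval G n x a = \<one>"
  unfolding lattice_eval_def using assms by (intro finprod_one_eqI) auto

end

section \<open>Exponents, and the lattices of the statement\<close>

lemma (in group) group_exp_pow:
  assumes "finite (carrier G)"
  shows "0 < group_exp G" "a \<in> carrier G \<Longrightarrow> a [^] group_exp G = \<one>"
proof -
  \<comment> \<open>The order of the finite group is an admissible exponent, so the
    \<open>LEAST\<close> in \<open>group_exp\<close> is attained.\<close>
  have "\<exists>s. 0 < s \<and> (\<forall>a \<in> carrier G. a [^] (s :: nat) = \<one>)"
    using assms pow_order_eq_1 order_gt_0_iff_finite by blast
  from LeastI_ex[OF this] show "0 < group_exp G" "a \<in> carrier G \<Longrightarrow> a [^] group_exp G = \<one>"
    by (auto simp: group_exp_def)
qed

lemma (in group) int_pow_eq_one: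
  assumes "a \<in> carrier G" "a [^] (m :: nat) = \<one>" "int m dvd k"
  shows "a [^] (k :: int) = \<one>"
proof -
  obtain c where "k = int m * c" using assms(3) by (auto simp: dvd_def)
  then have "a [^] k = (a [^] int m) [^] c" using assms(1) by (simp add: int_pow_pow)
  then show ?thesis using assms(2) by (simp add: int_pow_int)
qed

lemma subgroup_multiples_lattice: "subgroup (multiples_lattice n m) (int_lattice n)"
proof (rule group.subgroupI[OF group_int_lattice])
  show "multiples_lattice n m \<noteq> {}"
    using group.is_monoid[OF group_int_lattice, THEN monoid.one_closed, of n]
    unfolding multiples_lattice_def by (auto intro!: exI[of _ "\<one>\<^bsub>int_lattice n\<^esub>"] simp: one_int_lattice)
next
  fix a assume "a \<in> multiples_lattice n m"
  then show "inv\<^bsub>int_lattice n\<^esub> a \<in> multiples_lattice n m"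
    using group.inv_closed[OF group_int_lattice, of a n]
    by (simp add: multiples_lattice_def inv_int_lattice)
next
  fix a b assume "a \<in> multiples_lattice n m" "b \<in> multiples_lattice n m"
  then show "a \<otimes>\<^bsub>int_lattice n\<^esub> b \<in> multiples_lattice n m"
    using monoid.m_closed[OF group.is_monoid[OF group_int_lattice], of a n b]
    by (simp add: multiples_lattice_def mult_int_lattice)
qed (simp add: multiples_lattice_def)

text \<open>The two lists of generators are joined into one family, with \<open>y' j\<close> at
  index \<open>l + j\<close>. The relations then form the kernel of a single evaluation map.\<close>

lemma relation_lattice_eq_kernel:
  assumes B: "comm_group B" and y: "y \<in> {1..l} \<rightarrow> carrier B" "y' \<in> {1..l'} \<rightarrow> carrier B"
  shows "relation_lattice B l l' y y' =
    kernel (int_lattice (l + l')) B (lattice_eval B (l + l') (\<lambda>i. if i \<le> l then y i else y' (i - l)))"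
proof -
  interpret B: comm_group B by (rule B)
  let ?w = "\<lambda>i. if i \<le> l then y i else y' (i - l)"
  have w: "?w i \<in> carrier B" if "i \<in> {1..l + l'}" for i
  proof (cases "i \<le> l")
    case False
    then have "i - l \<in> {1..l'}" using that by auto
    then show ?thesis using False funcset_mem[OF y(2)] by simp
  qed (use that funcset_mem[OF y(1)] in simp)
  have "lattice_eval B (l + l') ?w a =
    (\<Otimes>\<^bsub>B\<^esub>i \<in> {1..l}. y i [^]\<^bsub>B\<^esub> a i) \<otimes>\<^bsub>B\<^esub> (\<Otimes>\<^bsub>B\<^esub>j \<in> {1..l'}. y' j [^]\<^bsub>B\<^esub> a (l + j))" for a
  proof -
    have split: "{1..l + l'} = {1..l} \<union> (+) l ` {1..l'}" by auto
    have "lattice_eval B (l + l') ?w a =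
      (\<Otimes>\<^bsub>B\<^esub>i \<in> {1..l}. ?w i [^]\<^bsub>B\<^esub> a i) \<otimes>\<^bsub>B\<^esub> (\<Otimes>\<^bsub>B\<^esub>i \<in> (+) l ` {1..l'}. ?w i [^]\<^bsub>B\<^esub> a i)"
      unfolding lattice_eval_def split
      by (intro B.finprod_Un_disjoint Pi_I B.int_pow_closed w) auto
    also have "(\<Otimes>\<^bsub>B\<^esub>i \<in> {1..l}. ?w i [^]\<^bsub>B\<^esub> a i) = (\<Otimes>\<^bsub>B\<^esub>i \<in> {1..l}. y i [^]\<^bsub>B\<^esub> a i)"
      using y by (intro B.finprod_cong') (auto simp: Pi_iff)
    also have "(\<Otimes>\<^bsub>B\<^esub>i \<in> (+) l ` {1..l'}. ?w i [^]\<^bsub>B\<^esub> a i) =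
      (\<Otimes>\<^bsub>B\<^esub>j \<in> {1..l'}. ?w (l + j) [^]\<^bsub>B\<^esub> a (l + j))"
      by (intro B.finprod_reindex Pi_I B.int_pow_closed w) auto
    also have "\<dots> = (\<Otimes>\<^bsub>B\<^esub>j \<in> {1..l'}. y' j [^]\<^bsub>B\<^esub> a (l + j))"
      using y by (intro B.finprod_cong') (auto simp: Pi_iff)
    finally show ?thesis .
  qed
  then show ?thesis by (auto simp: relation_lattice_def kernel_def)
qed

text \<open>A coset is computed from the multiplication alone, which restricting the carrier to
  \<open>H\<close> does not change.\<close>

lemma quotient_subset_eq: "quotient_subset G H N = (\<lambda>x. N #>\<^bsub>G\<^esub> x) ` H"
  by (simp add: quotient_subset_def carrier_FactGroup r_coset_def)

text \<open>The source of the modulus: raising to the power \<open>group_exp B\<close> moves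
  \<open>a\<close> into the kernel of \<open>f\<close>, a copy of \<open>F\<close>, and the power
  \<open>group_exp F\<close> then kills it.\<close>

lemma typical_covering_pow:
  assumes cov: "typical_covering A X f B Y" and B: "group B" "finite (carrier B)"
    and F: "group F" "finite (carrier F)"
    and ker: "A\<lparr>carrier := kernel A B f\<rparr> \<cong> F" and a: "a \<in> carrier A"
  shows "a [^]\<^bsub>A\<^esub> (group_exp B * group_exp F) = \<one>\<^bsub>A\<^esub>"
proof -
  interpret f: group_hom A B f
    using cov B by (auto simp: typical_covering_def epi_def group_hom_def group_hom_axioms_def
        comm_group.axioms(2))
  interpret F: group F by (rule F)
  let ?K = "A\<lparr>carrier := kernel A B f\<rparr>"
  have K: "group ?K" by (rule f.G.subgroup_imp_group[OF f.subgroup_kernel])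
  obtain h where h: "h \<in> iso ?K F" using ker by (auto simp: is_iso_def)
  interpret h: group_hom ?K F h
    using h K F by (auto simp: iso_def group_hom_def group_hom_axioms_def)
  let ?b = "a [^]\<^bsub>A\<^esub> group_exp B"
  have "f ?b = \<one>\<^bsub>B\<^esub>" using a f.H.group_exp_pow[OF B(2)] by (simp add: f.hom_nat_pow)
  then have b: "?b \<in> carrier ?K" using a by (simp add: kernel_def)
  have "h (?b [^]\<^bsub>?K\<^esub> group_exp F) = \<one>\<^bsub>F\<^esub>"
    using b F.group_exp_pow[OF F(2)] by (metis h.hom_closed h.hom_nat_pow)
  also have "\<dots> = h \<one>\<^bsub>?K\<^esub>" by (rule h.hom_one[symmetric])
  finally have "?b [^]\<^bsub>?K\<^esub> group_exp F = \<one>\<^bsub>?K\<^esub>"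
    using h b h.G.nat_pow_closed[OF b] h.G.one_closed by (metis (no_types, lifting) bij_betw_def inj_onD iso_def mem_Collect_eq)
  then have "?b [^]\<^bsub>A\<^esub> group_exp F = \<one>\<^bsub>A\<^esub>" by (simp flip: f.G.nat_pow_consistent)
  then show ?thesis using a by (simp add: f.G.nat_pow_pow)
qed

section \<open>The correspondence for the lattice quotient\<close>

theorem theorem2p3:
  fixes B :: "'b monoid" and Y :: "'b set"
    and A0 :: "'c monoid" and F :: "'d monoid"
    and l l' :: nat and y y' :: "nat \<Rightarrow> 'b"
  assumes B: "comm_group B" "finite (carrier B)"
    and A0: "comm_group A0" "finite (carrier A0)"
    and F: "comm_group F" "finite (carrier F)"
    and Y: "cayley_subset B Y" "generator_listing B Y l l' y y'"
    and connected: "connected_graph (Cay B Y)"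
    and universe: "infinite (UNIV :: 'u set)"
  defines "Z \<equiv> int_lattice (l + l')"
    and "RY \<equiv> relation_lattice B l l' y y'"
    and "R0 \<equiv> involution_lattice l l'"
    and "R \<equiv> multiples_lattice (l + l') (group_exp B * group_exp F)"
  defines "RY_bar \<equiv> quotient_subset Z RY R"
    and "R0_bar \<equiv> quotient_subset Z (R0 <#>\<^bsub>Z\<^esub> R) R"
  shows "\<exists>\<delta>. bij_betw \<delta>
    (covering_classes B Y A0 F :: ('u monoid \<times> 'u set \<times> ('u \<Rightarrow> 'b)) set set)
    {D. subgroup D ((Z Mod R)\<lparr>carrier := RY_bar\<rparr>) \<and> R0_bar \<subseteq> D \<and>
        (Z Mod R) Mod D \<cong> A0 \<and> ((Z Mod R)\<lparr>carrier := RY_bar\<rparr>) Mod D \<cong> F}"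
proof -
  interpret B: comm_group B by (rule B)
  interpret F: comm_group F by (rule F)
  define n where "n = l + l'"
  define m where "m = group_exp B * group_exp F"
  have Z_n: "Z = int_lattice n" and R_eq: "R = multiples_lattice n m"
    by (simp_all add: Z_def R_def n_def m_def)
  interpret Z: comm_group Z unfolding Z_n by (rule comm_group_int_lattice)
  have R_sub: "subgroup R Z" unfolding R_eq Z_n by (rule subgroup_multiples_lattice)
  interpret R: normal R Z by (rule Z.subgroup_imp_normal[OF R_sub])
  interpret Q: comm_group "Z Mod R" by (rule Z.abelian_FactGroup[OF R_sub])
  define w where "w i = (if i \<le> l then y i else y' (i - l))" for i
  have YB: "Y \<subseteq> carrier B" using Y(1) by (simp add: cayley_subset_def)
  have Y_list: "Y = y ` {1..l} \<union> (\<lambda>i. inv\<^bsub>B\<^esub> y i) ` {1..l} \<union> y' ` {1..l'}"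
    and y'_sq: "\<And>j. j \<in> {1..l'} \<Longrightarrow> y' j \<otimes>\<^bsub>B\<^esub> y' j = \<one>\<^bsub>B\<^esub>"
    and dist: "distinct (map y [1..<Suc l] @ map (\<lambda>i. inv\<^bsub>B\<^esub> y i) [1..<Suc l] @ map y' [1..<Suc l'])"
    using Y(2) unfolding generator_listing_def by blast+
  have y_inj: "inj_on y {1..l}" and y'_inj: "inj_on y' {1..l'}"
    and y_inv: "\<And>i k. \<lbrakk>i \<in> {1..l}; k \<in> {1..l}\<rbrakk> \<Longrightarrow> y i \<noteq> inv\<^bsub>B\<^esub> y k"
    and y_y': "\<And>i j. \<lbrakk>i \<in> {1..l}; j \<in> {1..l'}\<rbrakk> \<Longrightarrow> y i \<noteq> y' j \<and> inv\<^bsub>B\<^esub> y i \<noteq> y' j"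
  proof -
    have set_upt: "set [1..<Suc k] = {1..k}" for k by auto
    show "inj_on y {1..l}" "inj_on y' {1..l'}"
      using dist unfolding distinct_append distinct_map set_upt by blast+
    fix i assume "i \<in> {1..l}"
    then have i: "y i \<in> set (map y [1..<Suc l])"
      "inv\<^bsub>B\<^esub> y i \<in> set (map (\<lambda>i. inv\<^bsub>B\<^esub> y i) [1..<Suc l])"
      unfolding set_map set_upt by blast+
    show "y i \<noteq> inv\<^bsub>B\<^esub> y k" if "k \<in> {1..l}" for k
    proof -
      have "inv\<^bsub>B\<^esub> y k \<in> set (map (\<lambda>i. inv\<^bsub>B\<^esub> y i) [1..<Suc l])"
        using that unfolding set_map set_upt by blast
      then show ?thesis using i dist unfolding distinct_append set_append by (metis UnI1 disjoint_iff)
    qed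
    show "y i \<noteq> y' j \<and> inv\<^bsub>B\<^esub> y i \<noteq> y' j" if "j \<in> {1..l'}" for j
    proof -
      have "y' j \<in> set (map y' [1..<Suc l'])"
        using that unfolding set_map set_upt by blast
      then show ?thesis using i dist unfolding distinct_append set_append by (metis UnI2 disjoint_iff)
    qed
  qed
  have yB: "y \<in> {1..l} \<rightarrow> carrier B" and y'B: "y' \<in> {1..l'} \<rightarrow> carrier B"
    using YB unfolding Y_list by auto
  have index: "i \<in> {1..n} \<longleftrightarrow> i \<in> {1..l} \<or> (i \<in> {l+1..n} \<and> i - l \<in> {1..l'})" for i
    unfolding n_def by auto
  have w_y: "w i = y i" if "i \<in> {1..l}" for i using that by (simp add: w_def)
  have w_y': "w i = y' (i - l)" if "i \<in> {l+1..n}" for i using that by (simp add: w_def)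
  have w_cases: "(i \<in> {1..l} \<and> w i = y i) \<or> (i \<in> {l+1..n} \<and> i - l \<in> {1..l'} \<and> w i = y' (i - l))"
    if "i \<in> {1..n}" for i
    using that index w_y w_y' by blast
  have wB: "w \<in> {1..n} \<rightarrow> carrier B"
  proof
    fix i assume "i \<in> {1..n}"
    from w_cases[OF this] show "w i \<in> carrier B"
      using funcset_mem[OF yB] funcset_mem[OF y'B] by fastforce
  qed
  have inv_y': "inv\<^bsub>B\<^esub> y' j = y' j" if "j \<in> {1..l'}" for j
    using y'_sq[OF that] funcset_mem[OF y'B that] by (simp add: B.inv_equality)
  have w_image: "w ` {1..n} = y ` {1..l} \<union> y' ` {1..l'}"
  proof -
    have "w ` {1..l} = y ` {1..l}" using w_y by (intro image_cong) auto
    moreover have "w ` ((+) l ` {1..l'}) = y' ` {1..l'}"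
      unfolding image_image by (intro image_cong) (auto simp: w_def)
    moreover have "{1..n} = {1..l} \<union> (+) l ` {1..l'}" by (auto simp: n_def)
    ultimately show ?thesis by (simp only: image_Un)
  qed
  have inv_w_image: "(\<lambda>i. inv\<^bsub>B\<^esub> w i) ` {1..n} = (\<lambda>i. inv\<^bsub>B\<^esub> y i) ` {1..l} \<union> y' ` {1..l'}"
  proof -
    have "(\<lambda>i. inv\<^bsub>B\<^esub> w i) ` {1..n} = m_inv B ` y ` {1..l} \<union> m_inv B ` y' ` {1..l'}"
      using w_image by (metis image_Un image_image)
    moreover have "m_inv B ` y' ` {1..l'} = y' ` {1..l'}"
      unfolding image_image using inv_y' by (intro image_cong) auto
    ultimately show ?thesis by (simp only: image_image)
  qed
  have Y_w: "Y = w ` {1..n} \<union> (\<lambda>i. inv\<^bsub>B\<^esub> w i) ` {1..n}"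
    unfolding w_image inv_w_image Y_list by blast
  have w_inj: "inj_on w {1..n}"
  proof (rule inj_onI)
    fix i k assume ik: "i \<in> {1..n}" "k \<in> {1..n}" and eq: "w i = w k"
    consider "i \<in> {1..l}" "w i = y i" "k \<in> {1..l}" "w k = y k"
      | "i \<in> {1..l}" "w i = y i" "k - l \<in> {1..l'}" "w k = y' (k - l)"
      | "i - l \<in> {1..l'}" "w i = y' (i - l)" "k \<in> {1..l}" "w k = y k"
      | "i \<in> {l+1..n}" "k \<in> {l+1..n}" "i - l \<in> {1..l'}" "w i = y' (i - l)" "k - l \<in> {1..l'}" "w k = y' (k - l)"
      using w_cases[OF ik(1)] w_cases[OF ik(2)] by blast
    then show "i = k"
    proof cases
      case 1 then show ?thesis using eq y_inj by (metis inj_onD)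
    next
      case 2 then show ?thesis using eq y_y' by metis
    next
      case 3 then show ?thesis using eq y_y' by metis
    next
      case 4
      then have "i - l = k - l" using eq y'_inj by (metis inj_onD)
      then show ?thesis using 4 by auto
    qed
  qed
  \<comment> \<open>Distinctness of the listing rules out every entry \<open>y k\<close> as the
    inverse of a listed generator. Only involutions remain, and for these the equation reads
    \<open>w i = w k\<close>.\<close>
  have w_inv: "i = k \<and> i \<in> {l+1..n}" if ik: "i \<in> {1..n}" "k \<in> {1..n}" and eq: "w i = inv\<^bsub>B\<^esub> w k" for i k
    using w_cases[OF ik(2)]
  proof
    assume k: "k \<in> {1..l} \<and> w k = y k"
    then show ?thesis using w_cases[OF ik(1)] eq y_inv y_y' by metis
  next
    assume k: "k \<in> {l+1..n} \<and> k - l \<in> {1..l'} \<and> w k = y' (k - l)"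
    then have "w i = w k" using eq inv_y' by metis
    then have "i = k" using w_inj ik by (metis inj_onD)
    then show ?thesis using k by blast
  qed
  have w_invol: "w i = inv\<^bsub>B\<^esub> w i" if "i \<in> {l+1..n}" for i
  proof -
    have "i - l \<in> {1..l'}" using that by (auto simp: n_def)
    then show ?thesis using w_y'[OF that] inv_y' by simp
  qed
  define q where "q i = R #>\<^bsub>Z\<^esub> unit_vector n i" for i
  define eB where "eB = lattice_eval B n w"
  have eB_hom: "eB \<in> hom Z B" unfolding eB_def Z_n by (rule B.lattice_eval_hom[OF wB])
  interpret eB: group_hom Z B eB using eB_hom by unfold_locales
  have eB_unit: "eB (unit_vector n i) = w i" if "i \<in> {1..n}" for i
    unfolding eB_def by (rule B.lattice_eval_unit_vector[OF wB that])
  have unit_Z: "unit_vector n i \<in> carrier Z" for i unfolding Z_n by (rule unit_vector_closed)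
  have R_dvd: "a \<in> carrier Z \<and> (\<forall>i \<in> {1..n}. int m dvd a i)" if "a \<in> R" for a
    using that by (simp add: R_eq Z_n multiples_lattice_def)
  \<comment> \<open>The factor \<open>group_exp B\<close> of the modulus already kills the values in
    \<open>B\<close>; the factor \<open>group_exp F\<close> enters with the lifts to
    \<open>A\<close>.\<close>
  have R_ker: "R \<subseteq> kernel Z B eB"
  proof
    fix a assume a: "a \<in> R"
    have "eB a = \<one>\<^bsub>B\<^esub>" unfolding eB_def
    proof (rule B.lattice_eval_eq_one)
      fix i assume i: "i \<in> {1..n}"
      have "int (group_exp B) dvd a i" using R_dvd[OF a] i by (auto simp: m_def intro: dvd_mult_left)
      then show "w i [^]\<^bsub>B\<^esub> a i = \<one>\<^bsub>B\<^esub>"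
        using B.int_pow_eq_one B.group_exp_pow(2)[OF B(2)] funcset_mem[OF wB i] by blast
    qed
    then show "a \<in> kernel Z B eB" using R_dvd[OF a] by (simp add: kernel_def)
  qed
  obtain \<psi> where \<psi>_hom: "\<psi> \<in> hom (Z Mod R) B"
    and \<psi>: "\<And>a. a \<in> carrier Z \<Longrightarrow> \<psi> (R #>\<^bsub>Z\<^esub> a) = eB a"
    using eB.FactGroup_universal_kernel[OF R.normal_axioms R_ker] by blast
  have \<psi>_q: "\<psi> (q i) = w i" if "i \<in> {1..n}" for i
    using that by (simp add: q_def \<psi> unit_Z eB_unit)
  have \<pi>_hom: "(\<lambda>a. R #>\<^bsub>Z\<^esub> a) \<in> hom Z (Z Mod R)" by (rule R.r_coset_hom_Mod)
  interpret \<pi>: group_hom Z "Z Mod R" "\<lambda>a. R #>\<^bsub>Z\<^esub> a" using \<pi>_hom by unfold_locales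
  have q_closed: "q ` {1..n} \<subseteq> carrier (Z Mod R)"
    unfolding q_def using unit_Z \<pi>.hom_closed by blast
  have q_generate: "generate (Z Mod R) (q ` {1..n}) = carrier (Z Mod R)"
  proof -
    have "q ` {1..n} = (\<lambda>a. R #>\<^bsub>Z\<^esub> a) ` unit_vector n ` {1..n}" by (simp add: q_def image_image)
    moreover have "unit_vector n ` {1..n} \<subseteq> carrier Z" using unit_Z by blast
    ultimately have "generate (Z Mod R) (q ` {1..n}) =
      (\<lambda>a. R #>\<^bsub>Z\<^esub> a) ` generate Z (unit_vector n ` {1..n})"
      using \<pi>.generate_img by simp
    then show ?thesis using generate_unit_vectors[of n] by (simp add: carrier_FactGroup Z_n)
  qed
  \<comment> \<open>The marking consists of the classes of the unit vectors, and
    \<open>{l+1..n}\<close> indexes the involutions because \<open>w\<close> lists \<open>y'\<close>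
    after \<open>y\<close>.\<close>
  interpret marked_group "Z Mod R" B \<psi> "{1..n}" "{l+1..n}" q Y
  proof unfold_locales
    have "\<psi> ` q ` {1..n} = w ` {1..n}"
      unfolding image_image using \<psi>_q by (intro image_cong) auto
    moreover have "(\<lambda>i. inv\<^bsub>B\<^esub> \<psi> (q i)) ` {1..n} = (\<lambda>i. inv\<^bsub>B\<^esub> w i) ` {1..n}"
      using \<psi>_q by (intro image_cong) auto
    ultimately show "Y = \<psi> ` q ` {1..n} \<union> (\<lambda>i. inv\<^bsub>B\<^esub> \<psi> (q i)) ` {1..n}"
      using Y_w by simp
    show "inj_on (\<psi> \<circ> q) {1..n}"
      using w_inj by (rule inj_on_cong[THEN iffD1, rotated]) (simp add: \<psi>_q)
    show "i = k \<and> i \<in> {l+1..n}" if "i \<in> {1..n}" "k \<in> {1..n}" "\<psi> (q i) = inv\<^bsub>B\<^esub> \<psi> (q k)" for i k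
      using that w_inv[OF that(1,2)] \<psi>_q by simp
    show J: "{l+1..n} \<subseteq> {1..n}" by auto
    show "\<psi> (q i) = inv\<^bsub>B\<^esub> \<psi> (q i)" if "i \<in> {l+1..n}" for i
      using w_invol[OF that] \<psi>_q[of i] that J by auto
  qed (use \<psi>_hom Q.comm_group_axioms B Y connected q_closed q_generate in auto)
  have RY_bar_eq: "RY_bar = kernel (Z Mod R) B \<psi>"
  proof -
    have "RY = kernel Z B eB"
      using relation_lattice_eq_kernel[OF B(1) yB y'B]
      unfolding RY_def Z_n eB_def n_def w_def .
    then show ?thesis
      using \<psi> by (auto simp: RY_bar_def quotient_subset_eq kernel_def carrier_FactGroup)
  qed
  \<comment> \<open>This translates the condition on squares in the abstract correspondence: the
    involution lattice is generated by the doubles of the last \<open>l'\<close> unit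
    vectors.\<close>
  have R0_le_iff: "R0_bar \<subseteq> D \<longleftrightarrow> (\<forall>j \<in> {l+1..n}. q j \<otimes>\<^bsub>Z Mod R\<^esub> q j \<in> D)"
    if D: "subgroup D ((Z Mod R)\<lparr>carrier := RY_bar\<rparr>)" for D
  proof
    assume le: "R0_bar \<subseteq> D"
    show "\<forall>j \<in> {l+1..n}. q j \<otimes>\<^bsub>Z Mod R\<^esub> q j \<in> D"
    proof
      fix j assume j: "j \<in> {l+1..n}"
      let ?e = "unit_vector n j \<otimes>\<^bsub>Z\<^esub> unit_vector n j"
      have "?e \<in> carrier Z" using unit_Z by simp
      then have "?e \<in> R0"
        using j by (auto simp: R0_def involution_lattice_def n_def Z_n mult_int_lattice unit_vector_def)
      then have "?e \<otimes>\<^bsub>Z\<^esub> \<one>\<^bsub>Z\<^esub> \<in> R0 <#>\<^bsub>Z\<^esub> R"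
        using subgroup.one_closed[OF R_sub] unfolding set_mult_def by blast
      then have "R #>\<^bsub>Z\<^esub> ?e \<in> D" using le unit_Z unfolding R0_bar_def quotient_subset_eq by auto
      moreover have "R #>\<^bsub>Z\<^esub> ?e = q j \<otimes>\<^bsub>Z Mod R\<^esub> q j"
        unfolding q_def by (rule \<pi>.hom_mult[OF unit_Z unit_Z])
      ultimately show "q j \<otimes>\<^bsub>Z Mod R\<^esub> q j \<in> D" by simp
    qed
  next
    assume sq: "\<forall>j \<in> {l+1..n}. q j \<otimes>\<^bsub>Z Mod R\<^esub> q j \<in> D"
    have D_sub: "subgroup D (Z Mod R)"
      using D Q.incl_subgroup subgroup_kernel unfolding RY_bar_eq by blast
    \<comment> \<open>The preimage of \<open>D\<close> in the lattice. It contains \<open>R\<close>,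
      and membership of \<open>R0\<close> can be tested one coordinate at a time: the first
      \<open>l\<close> coordinates vanish and the others are even.\<close>
    define H where "H = {a \<in> carrier Z. R #>\<^bsub>Z\<^esub> a \<in> D}"
    have H: "subgroup H Z"
    proof (rule Z.subgroupI)
      show "H \<noteq> {}" using subgroup.one_closed[OF D_sub] Z.one_closed \<pi>.hom_one unfolding H_def by force
      show "inv\<^bsub>Z\<^esub> a \<in> H" if "a \<in> H" for a
        using that \<pi>.hom_inv[of a] subgroup.m_inv_closed[OF D_sub] unfolding H_def by force
      show "a \<otimes>\<^bsub>Z\<^esub> b \<in> H" if "a \<in> H" "b \<in> H" for a b
        using that \<pi>.hom_mult[of a b] subgroup.m_closed[OF D_sub] unfolding H_def by force
    qed (auto simp: H_def)
    have R0_H: "b \<in> H" if b: "b \<in> R0" for b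
    proof (rule mem_subgroup_int_lattice[of H n, folded Z_n, OF H])
      show "b \<in> carrier Z" using b by (simp add: R0_def involution_lattice_def Z_def)
      fix i assume i: "i \<in> {1..n}"
      show "unit_vector n i [^]\<^bsub>Z\<^esub> b i \<in> H"
      proof (cases "i \<in> {1..l}")
        case True
        then have "b i = 0" using b by (simp add: R0_def involution_lattice_def)
        then show ?thesis using subgroup.one_closed[OF H] by simp
      next
        case False
        then have ij: "i \<in> {l+1..n}" "i - l \<in> {1..l'}" "i = l + (i - l)" using i by (auto simp: n_def)
        then have "2 dvd b i" using b unfolding R0_def involution_lattice_def by (metis (no_types, lifting) mem_Collect_eq)
        then obtain c where "b i = 2 * c" by (auto simp: dvd_def)
        then have "unit_vector n i [^]\<^bsub>Z\<^esub> b i = (unit_vector n i [^]\<^bsub>Z\<^esub> (2 :: int)) [^]\<^bsub>Z\<^esub> c"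
          using unit_Z by (simp add: Z.int_pow_pow)
        moreover have "unit_vector n i [^]\<^bsub>Z\<^esub> (2 :: int) = unit_vector n i \<otimes>\<^bsub>Z\<^esub> unit_vector n i"
          using Z.int_pow_mult[OF unit_Z, of i 1 1] unit_Z by simp
        moreover have "unit_vector n i \<otimes>\<^bsub>Z\<^esub> unit_vector n i \<in> H"
          using sq ij(1) \<pi>.hom_mult[OF unit_Z unit_Z, of i i] unit_Z by (simp add: H_def q_def)
        ultimately show ?thesis using Z.subgroup_int_pow_closed[OF H] by simp
      qed
    qed
    have R_H: "r \<in> H" if "r \<in> R" for r
      using that R_sub subgroup.one_closed[OF D_sub] subgroup.mem_carrier[OF R_sub that] Z.coset_join2[of r R]
      by (simp add: H_def)
    show "R0_bar \<subseteq> D"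
    proof
      fix U assume "U \<in> R0_bar"
      then obtain b r where "b \<in> R0" "r \<in> R" "U = R #>\<^bsub>Z\<^esub> (b \<otimes>\<^bsub>Z\<^esub> r)"
        unfolding R0_bar_def quotient_subset_eq set_mult_def by blast
      then show "U \<in> D" using subgroup.m_closed[OF H] R0_H R_H unfolding H_def by blast
    qed
  qed
  have lift: "\<exists>\<phi>. lifts A X f \<phi>" if c: "(A, X, f) \<in> typical_coverings B Y A0 F"
    for A :: "'u monoid" and X f
  proof -
    have cov: "typical_covering A X f B Y" and ker: "A\<lparr>carrier := kernel A B f\<rparr> \<cong> F"
      using c by (auto simp: typical_coverings_def)
    then interpret A: comm_group A by (simp add: typical_covering_def)
    have XA: "X \<subseteq> carrier A" and fX: "f ` X = Y"
      using cov by (auto simp: typical_covering_def cayley_subset_def)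
    \<comment> \<open>The unique point of \<open>X\<close> over the generator \<open>w i\<close>.
      Evaluation at these points kills \<open>R\<close> by \<open>typical_covering_pow\<close>, and
      the induced map on \<open>Z Mod R\<close> is the required lift.\<close>
    define x where "x i = inv_into X f (w i)" for i
    have x: "x i \<in> X" "f (x i) = w i" if "i \<in> {1..n}" for i
    proof -
      have "w i \<in> f ` X" using that fX Y_w by auto
      then show "x i \<in> X" "f (x i) = w i" by (auto simp: x_def inv_into_into f_inv_into_f)
    qed
    have xA: "x \<in> {1..n} \<rightarrow> carrier A" using x XA by blast
    define eA where "eA = lattice_eval A n x"
    have eA_hom: "eA \<in> hom Z A" unfolding eA_def Z_n by (rule A.lattice_eval_hom[OF xA])
    interpret eA: group_hom Z A eA using eA_hom by unfold_locales
    have "R \<subseteq> kernel Z A eA"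
    proof
      fix a assume a: "a \<in> R"
      have "eA a = \<one>\<^bsub>A\<^esub>" unfolding eA_def
      proof (rule A.lattice_eval_eq_one)
        fix i assume i: "i \<in> {1..n}"
        show "x i [^]\<^bsub>A\<^esub> a i = \<one>\<^bsub>A\<^esub>"
          using A.int_pow_eq_one[OF funcset_mem[OF xA i], of m "a i"] R_dvd[OF a] i
            typical_covering_pow[OF cov B.group_axioms B(2) F.group_axioms F(2) ker funcset_mem[OF xA i]]
          by (simp add: m_def)
      qed
      then show "a \<in> kernel Z A eA" using R_dvd[OF a] by (simp add: kernel_def)
    qed
    then obtain \<phi> where \<phi>: "\<phi> \<in> hom (Z Mod R) A"
      "\<And>a. a \<in> carrier Z \<Longrightarrow> \<phi> (R #>\<^bsub>Z\<^esub> a) = eA a"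
      using eA.FactGroup_universal_kernel[OF R.normal_axioms] by blast
    have "\<phi> (q i) = x i" if "i \<in> {1..n}" for i
      using that \<phi>(2)[OF unit_Z] A.lattice_eval_unit_vector[OF xA that] by (simp add: q_def eA_def)
    then have "lifts A X f \<phi>"
      unfolding lifts_def using \<phi>(1) x \<psi>_q by simp
    then show ?thesis by blast
  qed
  have "{D. subgroup D ((Z Mod R)\<lparr>carrier := RY_bar\<rparr>) \<and> R0_bar \<subseteq> D \<and>
        (Z Mod R) Mod D \<cong> A0 \<and> ((Z Mod R)\<lparr>carrier := RY_bar\<rparr>) Mod D \<cong> F} =
    {D. subgroup D ((Z Mod R)\<lparr>carrier := RY_bar\<rparr>) \<and>
        (\<forall>j \<in> {l+1..n}. q j \<otimes>\<^bsub>Z Mod R\<^esub> q j \<in> D) \<and>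
        (Z Mod R) Mod D \<cong> A0 \<and> ((Z Mod R)\<lparr>carrier := RY_bar\<rparr>) Mod D \<cong> F}"
    using R0_le_iff by blast
  then show ?thesis
    using ex_bij_betw_covering_classes[OF universe A0(2) lift] unfolding RY_bar_eq by simp
qed

end
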